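(* Any family of non-intersecting anti-diagonal paths from $(1,n),(2,n),\dots,(r,n)$ to $(m,1),(m,2),\dots,(m,r)$ is a base of the matroid $\mathcal{M}(r,[m]\times[n])$; that is, if $P_1,\dots,P_r$ are pairwise disjoint anti-diagonal paths in $[m]\times[n]$ with $P_k$ a path from $(k,n)$ to $(m,k)$ for $k=1,\dots,r$, then $\Omega=P_1\cup\dots\cup P_r$ is a base of $\mathcal{M}(r,[m]\times[n])$.
   Context: $\Bbbk$ is an infinite field; $r,m,n$ are positive integers with $r<\min\{m,n\}$; $[m]=\{1,\dots,m\}$. $Z=(z_{ij})$ is an $m\times n$ matrix of variables and $I_{r+1}(Z)\subset\Bbbk[Z]$ is the (prime) ideal generated by all $(r+1)$-minors of $Z$. For $\Omega\subseteq[m]\times[n]$, $Z_\Omega=\{z_{ij}:(i,j)\in\Omega\}$. The determinantal matroid $\mathcal{M}(r,[m]\times[n])$ is the matroid on the ground set $[m]\times[n]$ in which $\Omega$ is independent if and only if $I_{r+1}(Z)\cap\Bbbk[Z_\Omega]=0$; its bases are the maximal independent sets. Consider on $[m]\times[n]$ the partial order in which $(i,j)\le(\alpha,\beta)$ if and only if $i\le\alpha$ and $j\ge\beta$. For $\xi_1\le\xi_2$, an anti-diagonal path from $\xi_1$ to $\xi_2$ is a maximal chain for this order whose minimum is $\xi_1$ and maximum is $\xi_2$ (maximal among chains with that minimum and maximum). A family of paths is non-intersecting if the paths are pairwise disjoint. *)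

theory Defs
  imports
    "HOL-Library.Poly_Mapping"
    "HOL-Library.Disjoint_Sets"
    "Jordan_Normal_Form.Determinant"
    "Jordan_Normal_Form.DL_Submatrix"
begin

section \<open>Polynomials in the entries of a generic matrix\<close>

text \<open>Monomials are finitely supported exponent vectors, polynomials are finitely supported
  coefficient functions on monomials, with the convolution product of
  \<^theory>\<open>HOL-Library.Poly_Mapping\<close>. The variable \<open>z\<^sub>i\<^sub>j\<close> has index \<open>(i, j)\<close>.\<close>

type_synonym 'k entry_poly = "((nat \<times> nat) \<Rightarrow>\<^sub>0 nat) \<Rightarrow>\<^sub>0 'k"

definition zvar :: "nat \<times> nat \<Rightarrow> 'k::field entry_poly" where
  "zvar v = Poly_Mapping.single (Poly_Mapping.single v 1) 1"

definition poly_vars :: "'k::field entry_poly \<Rightarrow> (nat \<times> nat) set" where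
  "poly_vars p = (\<Union>t \<in> Poly_Mapping.keys p. Poly_Mapping.keys t)"

text \<open>The subring \<open>\<k>[Z\<^sub>V]\<close>.\<close>

definition polys_in :: "(nat \<times> nat) set \<Rightarrow> 'k::field entry_poly set" where
  "polys_in V = {p. poly_vars p \<subseteq> V}"

text \<open>The ideal of the ring \<open>R\<close> generated by \<open>S \<subseteq> R\<close>.\<close>

definition ideal_gen :: "'a::comm_ring_1 set \<Rightarrow> 'a set \<Rightarrow> 'a set" where
  "ideal_gen R S = {(\<Sum>f\<in>F. q f * f) | F q. finite F \<and> F \<subseteq> S \<and> (\<forall>f\<in>F. q f \<in> R)}"

abbreviation grid :: "nat \<Rightarrow> nat \<Rightarrow> (nat \<times> nat) set" where
  "grid m n \<equiv> {1..m} \<times> {1..n}"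

text \<open>Positions in a value of type \<^typ>\<open>'a mat\<close> count from 0, whereas the indices of the
  variables count from 1.\<close>

definition generic_mat :: "nat \<Rightarrow> nat \<Rightarrow> 'k::field entry_poly mat" where
  "generic_mat m n = mat m n (\<lambda>(i, j). zvar (i + 1, j + 1))"

definition minors :: "nat \<Rightarrow> 'a::comm_ring_1 mat \<Rightarrow> 'a set" where
  "minors t A = {det (submatrix A I J) | I J.
     I \<subseteq> {..<dim_row A} \<and> J \<subseteq> {..<dim_col A} \<and> card I = t \<and> card J = t}"

definition det_ideal :: "nat \<Rightarrow> nat \<Rightarrow> nat \<Rightarrow> 'k::field entry_poly set" where
  "det_ideal t m n = ideal_gen (polys_in (grid m n)) (minors t (generic_mat m n))"

section \<open>The determinantal matroid\<close>

text \<open>A matroid is given by its family of independent sets. The coefficient field is passed as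
  a type argument, since it does not occur in the type of the result.\<close>

definition determinantal_matroid ::
    "'k::field itself \<Rightarrow> nat \<Rightarrow> nat \<Rightarrow> nat \<Rightarrow> (nat \<times> nat) set set" where
  "determinantal_matroid (_ :: 'k itself) r m n =
     {\<Omega>. \<Omega> \<subseteq> grid m n \<and> det_ideal (r + 1) m n \<inter> polys_in \<Omega> = {0 :: 'k entry_poly}}"

definition is_base :: "'a set set \<Rightarrow> 'a set \<Rightarrow> bool" where
  "is_base \<I> B \<longleftrightarrow> B \<in> \<I> \<and> (\<forall>B'\<in>\<I>. B \<subseteq> B' \<longrightarrow> B' = B)"

section \<open>Anti-diagonal paths\<close>

definition antidiag_order :: "nat \<Rightarrow> nat \<Rightarrow> (nat \<times> nat) rel" where
  "antidiag_order m n = {((i, j), (\<alpha>, \<beta>)).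
     (i, j) \<in> grid m n \<and> (\<alpha>, \<beta>) \<in> grid m n \<and> i \<le> \<alpha> \<and> \<beta> \<le> j}"

definition chain_between :: "'a rel \<Rightarrow> 'a \<Rightarrow> 'a \<Rightarrow> 'a set \<Rightarrow> bool" where
  "chain_between R a b C \<longleftrightarrow>
     C \<in> Chains R \<and> a \<in> C \<and> b \<in> C \<and> (\<forall>x\<in>C. (a, x) \<in> R \<and> (x, b) \<in> R)"

definition antidiag_path :: "nat \<Rightarrow> nat \<Rightarrow> nat \<times> nat \<Rightarrow> nat \<times> nat \<Rightarrow> (nat \<times> nat) set \<Rightarrow> bool" where
  "antidiag_path m n a b P \<longleftrightarrow>
     chain_between (antidiag_order m n) a b P \<and>
     (\<forall>C. chain_between (antidiag_order m n) a b C \<longrightarrow> P \<subseteq> C \<longrightarrow> C = P)"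

end

theory Submission
  imports Defs
begin

text \<open>A family of disjoint paths \<open>P 1, \<dots>, P r\<close> as in the theorem is a base for two reasons, one for
  each half of the definition.

  \<^emph>\<open>Independence.\<close> A polynomial in the ideal of the \<open>(r + 1)\<close>-minors vanishes on every matrix that
  factors through dimension \<open>r\<close>, in particular on the matrices with entries
  \<open>\<Sum>k = 1..r. t ^ (U i k + V k j)\<close> over \<open>\<k>[t]\<close>. The exponents can be chosen such that on the path
  \<open>P k\<close> the \<open>k\<close>-th summand has the strictly largest degree (\<open>row_weight_dominant\<close>). This is possible
  because disjoint paths do not cross (\<open>disjoint_paths_row_order\<close>): passing from the weights of one
  summand to those of the next adds a function of the row and a function of the column, and any
  staircase that separates two paths is the zero line of such a sum. So on the union of the paths
  the entries behave to first order like the monomials \<open>x\<^sub>i\<^sub>k * y\<^sub>k\<^sub>j\<close> with \<open>(i, j) \<in> P k\<close>. These are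
  algebraically independent, because the cells of a path, read as edges between rows and columns,
  form a forest (\<open>antidiag_chain_margins\<close>); after a generic perturbation of the exponents, different
  monomials in the entries on the paths have different degrees in \<open>t\<close>. Hence no nonzero polynomial
  in these entries vanishes (\<open>paths_independent\<close>).

  \<^emph>\<open>Maximality.\<close> Modulo the minors every monomial is a combination of monomials of the same degree
  whose support contains no main diagonal of an \<open>(r + 1)\<close>-minor (\<open>straightening\<close>). Looking at each
  diagonal \<open>i - j = c\<close> separately shows that a set of cells without such a diagonal is at most as
  large as the union of the paths (\<open>card_le_card_paths\<close>). A set with more cells carries too many
  monomials of bounded degree for all their normal forms to be linearly independent
  (\<open>dependent_if_larger_than_diagonal_free\<close>), so it supports a nonzero polynomial of the ideal.\<close>

section \<open>Anti-diagonal paths\<close>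

text \<open>Constant along each line parallel to the main diagonal and injective on every anti-diagonal
  chain, so it serves as the time parameter of a path.\<close>

definition diagonal :: "nat \<times> nat \<Rightarrow> int" where
  "diagonal v = int (fst v) - int (snd v)"

definition antidiag_chain :: "(nat \<times> nat) set \<Rightarrow> bool" where
  "antidiag_chain P \<longleftrightarrow> (\<forall>i j i' j'. (i, j) \<in> P \<longrightarrow> (i', j') \<in> P \<longrightarrow>
     (i \<le> i' \<and> j' \<le> j) \<or> (i' \<le> i \<and> j \<le> j'))"

lemma antidiag_chainD:
  assumes "antidiag_chain P" "(i, j) \<in> P" "(i', j') \<in> P"
  shows "(i \<le> i' \<and> j' \<le> j) \<or> (i' \<le> i \<and> j \<le> j')"
  using assms unfolding antidiag_chain_def by blast

lemma antidiag_chain_mono: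
  assumes "antidiag_chain P" "(i, j) \<in> P" "(i', j') \<in> P"
    and "diagonal (i, j) \<le> diagonal (i', j')"
  shows "i \<le> i' \<and> j' \<le> j"
  using antidiag_chainD[OF assms(1-3)] assms(4) by (auto simp: diagonal_def)

lemma antidiag_chain_inj: "antidiag_chain P \<Longrightarrow> inj_on diagonal P"
  by (rule inj_onI) (metis antidiag_chain_mono order.refl order.antisym prod.exhaust)

context
  fixes m n a1 a2 b1 b2 :: nat and P :: "(nat \<times> nat) set"
  assumes path: "antidiag_path m n (a1, a2) (b1, b2) P"
begin

lemma antidiag_path_ends: "(a1, a2) \<in> P" "(b1, b2) \<in> P"
  using path by (auto simp: antidiag_path_def chain_between_def)

lemma antidiag_path_box:
  assumes "(i, j) \<in> P"
  shows "(i, j) \<in> grid m n" "a1 \<le> i" "i \<le> b1" "b2 \<le> j" "j \<le> a2"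
  using path assms
  by (auto simp: antidiag_path_def chain_between_def antidiag_order_def)

lemma antidiag_path_chain: "antidiag_chain P"
proof -
  have "\<forall>x\<in>P. \<forall>y\<in>P. (x, y) \<in> antidiag_order m n \<or> (y, x) \<in> antidiag_order m n"
    using path unfolding antidiag_path_def chain_between_def Chains_def by blast
  then show ?thesis
    unfolding antidiag_chain_def antidiag_order_def by fastforce
qed

lemma antidiag_path_finite: "finite P"
  by (rule finite_subset[of _ "grid m n"]) (use antidiag_path_box(1) in auto)

text \<open>If the cell were missing, adding it would give a larger chain with the same ends.\<close>

lemma antidiag_path_maximal:
  assumes "(i, j) \<in> grid m n" "a1 \<le> i" "i \<le> b1" "b2 \<le> j" "j \<le> a2"
    and comp: "\<And>i' j'. (i', j') \<in> P \<Longrightarrow> (i \<le> i' \<and> j' \<le> j) \<or> (i' \<le> i \<and> j \<le> j')"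
  shows "(i, j) \<in> P"
proof -
  have cb: "chain_between (antidiag_order m n) (a1, a2) (b1, b2) P"
    and max: "\<And>C. chain_between (antidiag_order m n) (a1, a2) (b1, b2) C \<Longrightarrow> P \<subseteq> C \<Longrightarrow> C = P"
    using path by (auto simp: antidiag_path_def)
  have ends: "(a1, a2) \<in> grid m n" "(b1, b2) \<in> grid m n"
    using antidiag_path_ends antidiag_path_box(1) by auto
  have "insert (i, j) P \<in> Chains (antidiag_order m n)"
  proof -
    have "(x, y) \<in> antidiag_order m n \<or> (y, x) \<in> antidiag_order m n"
      if "x \<in> insert (i, j) P" "y \<in> insert (i, j) P" for x y
    proof -
      have "x \<in> grid m n" "y \<in> grid m n"
        using that assms(1) antidiag_path_box(1) by (cases x; cases y; force)+
      moreover have "(fst x \<le> fst y \<and> snd y \<le> snd x) \<or> (fst y \<le> fst x \<and> snd x \<le> snd y)"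
        using that comp antidiag_chainD[OF antidiag_path_chain]
        by (cases x; cases y) (auto; blast)
      ultimately show ?thesis
        by (cases x; cases y) (auto simp: antidiag_order_def)
    qed
    then show ?thesis unfolding Chains_def by blast
  qed
  then have "chain_between (antidiag_order m n) (a1, a2) (b1, b2) (insert (i, j) P)"
    using cb assms(1-5) ends unfolding chain_between_def
    by (auto simp: antidiag_order_def)
  from max[OF this] show ?thesis by blast
qed

text \<open>A path cannot jump over a diagonal: from the last cell before the gap, one step towards the
  first cell after it leads to a cell that is comparable with the whole path, and by maximality
  the path would contain that cell.\<close>

lemma antidiag_path_meets_diagonal:
  assumes c: "diagonal (a1, a2) \<le> c" "c \<le> diagonal (b1, b2)"
  obtains i j where "(i, j) \<in> P" "diagonal (i, j) = c"
proof (rule ccontr)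
  assume "\<not> thesis"
  then have miss: "\<And>v. v \<in> P \<Longrightarrow> diagonal v \<noteq> c" using that by auto
  define A where "A = {v \<in> P. diagonal v < c}"
  have "finite A" using antidiag_path_finite by (simp add: A_def)
  moreover have "(a1, a2) \<in> A"
    using miss[OF antidiag_path_ends(1)] antidiag_path_ends(1) c(1) by (auto simp: A_def)
  ultimately have "Max (diagonal ` A) \<in> diagonal ` A" by (intro Max_in) auto
  then obtain x where x: "x \<in> A" "diagonal x = Max (diagonal ` A)" by auto
  have last: "diagonal v \<le> diagonal x" if "v \<in> A" for v
    using x(2) \<open>finite A\<close> that by simp
  define B where "B = {v \<in> P. c < diagonal v}"
  have "finite B" using antidiag_path_finite by (simp add: B_def)
  moreover have "(b1, b2) \<in> B"
    using miss[OF antidiag_path_ends(2)] antidiag_path_ends(2) c(2) by (auto simp: B_def)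
  ultimately have "Min (diagonal ` B) \<in> diagonal ` B" by (intro Min_in) auto
  then obtain y where y: "y \<in> B" "diagonal y = Min (diagonal ` B)" by auto
  have first: "diagonal y \<le> diagonal v" if "v \<in> B" for v
    using y(2) \<open>finite B\<close> that by simp
  obtain i j where xij: "x = (i, j)" by fastforce
  obtain p q where ypq: "y = (p, q)" by fastforce
  have xP: "(i, j) \<in> P" and yP: "(p, q) \<in> P" using x(1) y(1) xij ypq by (auto simp: A_def B_def)
  have gap: "diagonal (i, j) < c" "c < diagonal (p, q)"
    using x(1) y(1) xij ypq by (auto simp: A_def B_def)
  have le: "i \<le> p" "q \<le> j"
    using antidiag_chain_mono[OF antidiag_path_chain xP yP] gap by auto
  \<comment> \<open>a unit step down if \<open>y\<close> lies further down, otherwise a unit step to the left\<close>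
  define z where "z = (if i < p then (i + 1, j) else (i, j - 1))"
  obtain u w where zuw: "z = (u, w)" by fastforce
  have between: "i \<le> u" "u \<le> p" "q \<le> w" "w \<le> j"
    and dz: "diagonal (u, w) = diagonal (i, j) + 1"
    using le gap zuw by (auto simp: z_def diagonal_def split: if_splits)
  note bx = antidiag_path_box[OF xP] and yx = antidiag_path_box[OF yP]
  have "(u, w) \<in> P"
  proof (rule antidiag_path_maximal)
    show "(u, w) \<in> grid m n" "a1 \<le> u" "u \<le> b1" "b2 \<le> w" "w \<le> a2"
      using bx yx between by auto
    fix i' j' assume v: "(i', j') \<in> P"
    show "(u \<le> i' \<and> j' \<le> w) \<or> (i' \<le> u \<and> w \<le> j')"
    proof (cases "diagonal (i', j') < c")
      case True
      then have "diagonal (i', j') \<le> diagonal (i, j)" using last v xij by (auto simp: A_def)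
      from antidiag_chain_mono[OF antidiag_path_chain v xP this] between show ?thesis by auto
    next
      case False
      then have "diagonal (p, q) \<le> diagonal (i', j')"
        using first v ypq miss[OF v] by (auto simp: B_def)
      from antidiag_chain_mono[OF antidiag_path_chain yP v this] between show ?thesis by auto
    qed
  qed
  moreover have "diagonal (u, w) \<le> c" using dz gap by simp
  ultimately have "(u, w) \<in> A" using miss[of "(u, w)"] by (auto simp: A_def)
  from last[OF this] dz xij show False by simp
qed

lemma card_antidiag_path_diagonal:
  "card {v \<in> P. diagonal v = c} =
     (if diagonal (a1, a2) \<le> c \<and> c \<le> diagonal (b1, b2) then 1 else 0)"
proof (cases "diagonal (a1, a2) \<le> c \<and> c \<le> diagonal (b1, b2)")
  case True
  then obtain i j where ij: "(i, j) \<in> P" "diagonal (i, j) = c"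
    using antidiag_path_meets_diagonal by blast
  then have "{v \<in> P. diagonal v = c} = {(i, j)}"
    using antidiag_chain_inj[OF antidiag_path_chain] by (auto dest: inj_onD)
  then show ?thesis using True by simp
next
  case False
  have "{v \<in> P. diagonal v = c} = {}"
    using False antidiag_path_box by (force simp: diagonal_def)
  then show ?thesis unfolding if_not_P[OF False] by (metis card.empty)
qed

end

text \<open>A discrete intermediate value argument. From one diagonal to the next the row of either path
  grows by 0 or 1, so the difference of the two rows changes by at most 1 and cannot change its
  sign without vanishing, which would be a common cell. On the first diagonal of the second path
  that path is at the right border of the grid, hence as low as possible on this diagonal.\<close>

lemma disjoint_paths_diagonal_order:
  assumes P: "antidiag_path m n (k, n) (m, k) P" and Q: "antidiag_path m n (l, n) (m, l) Q"
    and "k < l" and disj: "P \<inter> Q = {}"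
    and "diagonal (i', j') = diagonal (i, j)" "(i, j) \<in> P" "(i', j') \<in> Q"
  shows "i < i'"
proof -
  note cP = antidiag_path_chain[OF P] and cQ = antidiag_path_chain[OF Q]
  have base: "diagonal (l, n) \<le> diagonal (i, j)"
    using antidiag_path_box[OF Q \<open>(i', j') \<in> Q\<close>] assms(5) by (auto simp: diagonal_def)
  have same: "(i', j') = (l, n)" if "(i', j') \<in> Q" "diagonal (i', j') = diagonal (l, n)" for i' j'
    using antidiag_chain_inj[OF cQ] antidiag_path_ends(1)[OF Q] that by (auto dest: inj_onD)
  have "\<forall>i j i' j'. diagonal (i, j) = c \<longrightarrow> diagonal (i', j') = c \<longrightarrow>
      (i, j) \<in> P \<longrightarrow> (i', j') \<in> Q \<longrightarrow> i < i'" if "diagonal (l, n) \<le> c" for c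
    using that
  proof (induction c rule: int_ge_induct)
    case base
    show ?case
    proof (intro allI impI)
      fix i j i' j' assume *: "diagonal (i, j) = diagonal (l, n)" "diagonal (i', j') = diagonal (l, n)"
        "(i, j) \<in> P" "(i', j') \<in> Q"
      have "(i', j') = (l, n)" using same * by blast
      moreover have "j \<le> n" using antidiag_path_box[OF P *(3)] by auto
      moreover have "(i, j) \<noteq> (i', j')" using * disj by auto
      ultimately show "i < i'" using *(1) by (auto simp: diagonal_def)
    qed
  next
    case (step c)
    show ?case
    proof (intro allI impI)
      fix x y x' y' assume *: "diagonal (x, y) = c + 1" "diagonal (x', y') = c + 1"
        "(x, y) \<in> P" "(x', y') \<in> Q"
      have "diagonal (k, n) \<le> c" "diagonal (l, n) \<le> c" using step.hyps \<open>k < l\<close> by (auto simp: diagonal_def)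
      moreover have "c \<le> diagonal (m, k)" "c \<le> diagonal (m, l)"
        using *(1,2) antidiag_path_box[OF P *(3)] antidiag_path_box[OF Q *(4)]
        by (auto simp: diagonal_def)
      ultimately obtain i j i' j' where ij: "(i, j) \<in> P" "diagonal (i, j) = c"
        and ij': "(i', j') \<in> Q" "diagonal (i', j') = c"
        using antidiag_path_meets_diagonal[OF P] antidiag_path_meets_diagonal[OF Q] by metis
      have "i < i'" using step.IH ij ij' by blast
      moreover have "i \<le> x \<and> y \<le> j" "i' \<le> x' \<and> y' \<le> j'"
        using antidiag_chain_mono[OF cP ij(1) *(3)] antidiag_chain_mono[OF cQ ij'(1) *(4)] ij ij' *
        by auto
      moreover have "(x, y) \<noteq> (x', y')" using * disj by auto
      ultimately show "x < x'" using * ij ij' by (auto simp: diagonal_def)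
    qed
  qed
  from this[OF base] show ?thesis using assms by blast
qed

text \<open>The path of smaller index stays on the upper left of the other one. If it were to the right of
  the other one in some row, then on the later diagonal through the other one's cell it would have
  to be strictly above that row, although the row only grows along a path.\<close>

lemma disjoint_paths_row_order:
  assumes P: "antidiag_path m n (k, n) (m, k) P" and Q: "antidiag_path m n (l, n) (m, l) Q"
    and "k < l" and disj: "P \<inter> Q = {}" and ij: "(i, j) \<in> P" and ij': "(i, j') \<in> Q"
  shows "j < j'"
proof (rule ccontr)
  assume "\<not> j < j'"
  then have "j' \<le> j" by simp
  then have le: "diagonal (i, j) \<le> diagonal (i, j')" by (simp add: diagonal_def)
  have "diagonal (k, n) \<le> diagonal (i, j')" "diagonal (i, j') \<le> diagonal (m, k)"
    using antidiag_path_box[OF Q ij'] \<open>k < l\<close> by (auto simp: diagonal_def)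
  then obtain x y where xy: "(x, y) \<in> P" "diagonal (x, y) = diagonal (i, j')"
    using antidiag_path_meets_diagonal[OF P] by metis
  have "x < i"
    using disjoint_paths_diagonal_order[OF P Q \<open>k < l\<close> disj _ xy(1) ij'] xy(2) by simp
  moreover have "i \<le> x"
    using antidiag_chain_mono[OF antidiag_path_chain[OF P] ij xy(1)] xy(2) le by simp
  ultimately show False by simp
qed

section \<open>Cells on diagonals\<close>

text \<open>The cells \<open>(i s, j s)\<close> are exactly the positions on the main diagonal of some \<open>t\<close>-minor of the
  generic matrix.\<close>

definition has_diagonal :: "nat \<Rightarrow> (nat \<times> nat) set \<Rightarrow> bool" where
  "has_diagonal t S \<longleftrightarrow> (\<exists>i j. strict_mono_on {..<t} i \<and> strict_mono_on {..<t} j \<and>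
     (\<forall>s<t. (i s, j s) \<in> S))"

lemma has_diagonal_on_diagonal:
  assumes "t \<le> card {v \<in> S. diagonal v = c}"
  shows "has_diagonal t S"
proof -
  let ?D = "{v \<in> S. diagonal v = c}"
  define i where "i = pick (fst ` ?D)"
  define j where "j s = nat (int (i s) - c)" for s
  have "inj_on fst ?D" by (rule inj_onI) (auto simp: diagonal_def)
  then have "card (fst ` ?D) = card ?D" by (rule card_image)
  then have s: "s < card (fst ` ?D)" if "s < t" for s using that assms by simp
  have mem: "(i s, j s) \<in> S" "int (j s) = int (i s) - c" if "s < t" for s
    using pick_in_set_le[OF s[OF that]] by (auto simp: i_def j_def diagonal_def)
  have mono: "i s < i s'" if "s < s'" "s' < t" for s s'
    using pick_mono_le[OF s[OF that(2)] that(1)] by (simp add: i_def)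
  have "j s < j s'" if "s < s'" "s' < t" for s s'
    using mem(2)[of s] mem(2)[of s'] mono[OF that] that by linarith
  then show ?thesis unfolding has_diagonal_def
    using mono mem(1) by (intro exI[of _ i] exI[of _ j]) (auto simp: strict_mono_on_def)
qed

context
  fixes r m n :: nat and P :: "nat \<Rightarrow> (nat \<times> nat) set"
  assumes paths: "\<And>k. k \<in> {1..r} \<Longrightarrow> antidiag_path m n (k, n) (m, k) (P k)"
    and disj: "disjoint_family_on P {1..r}"
begin

lemma paths_in_grid: "(\<Union>k\<in>{1..r}. P k) \<subseteq> grid m n"
  using paths antidiag_path_box(1) by fast

lemma card_paths_diagonal:
  "card {v \<in> (\<Union>k\<in>{1..r}. P k). diagonal v = c} =
     card {k \<in> {1..r}. int k \<le> int n + c \<and> int k \<le> int m - c}"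
proof -
  have "{v \<in> (\<Union>k\<in>{1..r}. P k). diagonal v = c} = (\<Union>k\<in>{1..r}. {v \<in> P k. diagonal v = c})"
    by auto
  also have "card \<dots> = (\<Sum>k\<in>{1..r}. card {v \<in> P k. diagonal v = c})"
    using antidiag_path_finite[OF paths] disj
    by (intro card_UN_disjoint) (auto simp: disjoint_family_on_def)
  also have "\<dots> = (\<Sum>k\<in>{1..r}. if int k \<le> int n + c \<and> int k \<le> int m - c then 1 else 0)"
    by (intro sum.cong refl, subst card_antidiag_path_diagonal[OF paths])
       (auto simp: diagonal_def)
  also have "\<dots> = card {k \<in> {1..r}. int k \<le> int n + c \<and> int k \<le> int m - c}"
    by (subst sum.If_cases) (auto intro!: arg_cong[where f = card])
  finally show ?thesis .
qed

text \<open>The union of the paths has the largest possible number of cells on every single diagonal: a set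
  without long diagonals has there at most \<open>r\<close> cells and at most as many as the diagonal has, and
  the paths that cross the diagonal attain the minimum of these bounds.\<close>

lemma card_le_card_paths:
  assumes S: "S \<subseteq> grid m n" and nd: "\<not> has_diagonal (r + 1) S"
  shows "card S \<le> card (\<Union>k\<in>{1..r}. P k)"
proof -
  define \<Omega> where "\<Omega> = (\<Union>k\<in>{1..r}. P k)"
  have on_diagonal: "card {v \<in> S. diagonal v = c} \<le> card {v \<in> \<Omega>. diagonal v = c}" for c
  proof -
    let ?D = "{v \<in> S. diagonal v = c}"
    have "card ?D \<le> r" using has_diagonal_on_diagonal[of "r + 1" S c] nd by fastforce
    moreover have "card ?D \<le> card {1..nat (int n + c)}"
      using S by (intro card_inj_on_le[of fst]) (fastforce simp: inj_on_def diagonal_def)+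
    moreover have "card ?D \<le> card {1..nat (int m - c)}"
      using S by (intro card_inj_on_le[of snd]) (fastforce simp: inj_on_def diagonal_def)+
    ultimately have "{1..card ?D} \<subseteq> {k \<in> {1..r}. int k \<le> int n + c \<and> int k \<le> int m - c}"
      by auto
    from card_mono[OF _ this] show ?thesis unfolding \<Omega>_def card_paths_diagonal by simp
  qed
  have fibres: "card T = (\<Sum>c\<in>diagonal ` grid m n. card {v \<in> T. diagonal v = c})"
    if "T \<subseteq> grid m n" for T
  proof -
    have "finite T" using that by (rule finite_subset) auto
    then have "(\<Sum>c\<in>diagonal ` grid m n. sum (\<lambda>_. 1::nat) {v \<in> T. diagonal v = c}) = sum (\<lambda>_. 1) T"
      using that by (intro sum.group) auto
    then show ?thesis by simp
  qed
  show ?thesis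
    using fibres[OF S] fibres[OF paths_in_grid] on_diagonal
    by (simp add: \<Omega>_def sum_mono)
qed

end

section \<open>Polynomials, ideals and minors\<close>

lemma keys_uminus_subset: "Poly_Mapping.keys (- p :: 'a \<Rightarrow>\<^sub>0 'b::ab_group_add) \<subseteq> Poly_Mapping.keys p"
  by (auto simp: in_keys_iff)

lemma keys_sum_subset:
  assumes "\<And>x. x \<in> X \<Longrightarrow> Poly_Mapping.keys (f x) \<subseteq> K"
  shows "Poly_Mapping.keys (\<Sum>x\<in>X. f x) \<subseteq> K"
  using assms
proof (induction X rule: infinite_finite_induct)
  case (insert x X)
  then show ?case using Poly_Mapping.keys_add[of "f x" "sum f X"] by fastforce
qed auto

lemma polys_in_iff: "p \<in> polys_in V \<longleftrightarrow> (\<forall>t\<in>Poly_Mapping.keys p. Poly_Mapping.keys t \<subseteq> V)"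
  by (auto simp: polys_in_def poly_vars_def)

lemma polys_in_zero: "0 \<in> polys_in V"
  and polys_in_one: "1 \<in> polys_in V"
  by (simp_all add: polys_in_iff)

lemma polys_in_add: "p \<in> polys_in V \<Longrightarrow> q \<in> polys_in V \<Longrightarrow> p + q \<in> polys_in V"
  using Poly_Mapping.keys_add[of p q] by (auto simp: polys_in_iff)

lemma polys_in_uminus: "p \<in> polys_in V \<Longrightarrow> - p \<in> polys_in V"
  using keys_uminus_subset[of p] by (auto simp: polys_in_iff)

lemma polys_in_mult:
  assumes "p \<in> polys_in V" "q \<in> polys_in V"
  shows "p * q \<in> polys_in V"
  unfolding polys_in_iff
proof
  fix t assume "t \<in> Poly_Mapping.keys (p * q)"
  then obtain a b where "t = a + b" "a \<in> Poly_Mapping.keys p" "b \<in> Poly_Mapping.keys q"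
    using Poly_Mapping.keys_mult[of p q] by blast
  then show "Poly_Mapping.keys t \<subseteq> V"
    using assms Poly_Mapping.keys_add[of a b] unfolding polys_in_iff by blast
qed

lemma polys_in_single: "Poly_Mapping.keys t \<subseteq> V \<Longrightarrow> Poly_Mapping.single t c \<in> polys_in V"
  by (simp add: polys_in_iff)

lemma zero_in_ideal_gen: "0 \<in> ideal_gen R S"
  unfolding ideal_gen_def by (auto intro!: exI[of _ "{}"])

lemma mult_in_ideal_gen:
  assumes "f \<in> S" "q \<in> R" shows "q * f \<in> ideal_gen R S"
  unfolding ideal_gen_def using assms by (auto intro!: exI[of _ "{f}"] exI[of _ "\<lambda>_. q"])

lemma ideal_gen_add:
  assumes R: "0 \<in> R" "\<And>a b. a \<in> R \<Longrightarrow> b \<in> R \<Longrightarrow> a + b \<in> R"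
    and "x \<in> ideal_gen R S" "y \<in> ideal_gen R S"
  shows "x + y \<in> ideal_gen R S"
proof -
  obtain F q where F: "x = (\<Sum>f\<in>F. q f * f)" "finite F" "F \<subseteq> S" "\<forall>f\<in>F. q f \<in> R"
    using assms(3) by (auto simp: ideal_gen_def)
  obtain G p where G: "y = (\<Sum>f\<in>G. p f * f)" "finite G" "G \<subseteq> S" "\<forall>f\<in>G. p f \<in> R"
    using assms(4) by (auto simp: ideal_gen_def)
  define q' where "q' f = (if f \<in> F then q f else 0)" for f
  define p' where "p' f = (if f \<in> G then p f else 0)" for f
  have "x = (\<Sum>f\<in>F \<union> G. q' f * f)" unfolding F(1)
    by (rule sum.mono_neutral_cong_left) (use F G in \<open>auto simp: q'_def\<close>)
  moreover have "y = (\<Sum>f\<in>F \<union> G. p' f * f)" unfolding G(1)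
    by (rule sum.mono_neutral_cong_left) (use F G in \<open>auto simp: p'_def\<close>)
  ultimately have "x + y = (\<Sum>f\<in>F \<union> G. (q' f + p' f) * f)"
    by (simp add: sum.distrib distrib_right)
  moreover have "\<forall>f\<in>F \<union> G. q' f + p' f \<in> R"
    using F G R by (auto simp: q'_def p'_def)
  ultimately show ?thesis unfolding ideal_gen_def
    using F G by (auto intro!: exI[of _ "F \<union> G"] exI[of _ "\<lambda>f. q' f + p' f"])
qed

lemma ideal_gen_mult:
  assumes R: "\<And>a b. a \<in> R \<Longrightarrow> b \<in> R \<Longrightarrow> a * b \<in> R" and "a \<in> R" "x \<in> ideal_gen R S"
  shows "a * x \<in> ideal_gen R S"
proof -
  obtain F q where F: "x = (\<Sum>f\<in>F. q f * f)" "finite F" "F \<subseteq> S" "\<forall>f\<in>F. q f \<in> R"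
    using assms(3) by (auto simp: ideal_gen_def)
  then have "a * x = (\<Sum>f\<in>F. (a * q f) * f)" by (simp add: sum_distrib_left mult.assoc)
  then show ?thesis unfolding ideal_gen_def
    using F R \<open>a \<in> R\<close> by (auto intro!: exI[of _ F] exI[of _ "\<lambda>f. a * q f"])
qed

lemma det_ideal_add:
  "x \<in> det_ideal t m n \<Longrightarrow> y \<in> det_ideal t m n \<Longrightarrow> x + y \<in> det_ideal t m n"
  unfolding det_ideal_def by (rule ideal_gen_add[OF polys_in_zero polys_in_add])

lemma det_ideal_mult:
  "a \<in> polys_in (grid m n) \<Longrightarrow> x \<in> det_ideal t m n \<Longrightarrow> a * x \<in> det_ideal t m n"
  unfolding det_ideal_def by (rule ideal_gen_mult[OF polys_in_mult])

lemma zero_in_det_ideal: "0 \<in> det_ideal t m n"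
  unfolding det_ideal_def by (rule zero_in_ideal_gen)

lemma det_ideal_sum:
  assumes "\<And>x. x \<in> X \<Longrightarrow> f x \<in> det_ideal t m n"
  shows "(\<Sum>x\<in>X. f x) \<in> det_ideal t m n"
  using assms
  by (induction X rule: infinite_finite_induct) (simp_all add: det_ideal_add zero_in_det_ideal)

lemma pick_strict_mono:
  assumes f: "strict_mono_on {..<t} f" and "s < t"
  shows "pick (f ` {..<t}) s = f s"
proof -
  have inj: "inj_on f {..<t}" using f by (rule strict_mono_on_imp_inj_on)
  have "{a \<in> f ` {..<t}. a < f s} = f ` {..<s}"
    using strict_mono_on_less[OF f] \<open>s < t\<close> by auto
  moreover have "card (f ` {..<s}) = s"
    using inj_on_subset[OF inj, of "{..<s}"] \<open>s < t\<close> by (simp add: card_image)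
  ultimately show ?thesis using pick_card_in_set[of "f s" "f ` {..<t}"] \<open>s < t\<close> by auto
qed

text \<open>The Leibniz expansion of the minor with the given rows and columns; the shift by 1 between
  matrix positions and indices of variables is dealt with here once and for all.\<close>

lemma minor_of_diagonal:
  assumes i: "strict_mono_on {..<t} i" and j: "strict_mono_on {..<t} j"
    and grid: "\<And>s. s < t \<Longrightarrow> (i s, j s) \<in> grid m n"
  shows "(\<Sum>p | p permutes {0..<t}. signof p * (\<Prod>s = 0..<t. zvar (i s, j (p s))))
    \<in> minors t (generic_mat m n :: 'k::field entry_poly mat)"
proof -
  define i' where "i' s = i s - 1" for s
  define j' where "j' s = j s - 1" for s
  have pos: "1 \<le> i s" "i s \<le> m" "1 \<le> j s" "j s \<le> n" if "s < t" for s using grid[OF that] by auto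
  have i': "strict_mono_on {..<t} i'"
  proof (rule strict_mono_onI)
    fix r s assume "r \<in> {..<t}" "s \<in> {..<t}" "r < s"
    then have "i r < i s" "1 \<le> i r" using i pos(1) by (auto simp: strict_mono_on_def)
    then show "i' r < i' s" by (simp add: i'_def)
  qed
  have j': "strict_mono_on {..<t} j'"
  proof (rule strict_mono_onI)
    fix r s assume "r \<in> {..<t}" "s \<in> {..<t}" "r < s"
    then have "j r < j s" "1 \<le> j r" using j pos(3) by (auto simp: strict_mono_on_def)
    then show "j' r < j' s" by (simp add: j'_def)
  qed
  let ?Z = "generic_mat m n :: 'k entry_poly mat"
  define I where "I = i' ` {..<t}"
  define J where "J = j' ` {..<t}"
  have lt: "i' s < m" "j' s < n" if "s < t" for s using pos[OF that] by (auto simp: i'_def j'_def)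
  have cards: "card I = t" "card J = t"
    using i' j' by (auto simp: I_def J_def card_image strict_mono_on_imp_inj_on)
  have IJ: "I \<subseteq> {..<dim_row ?Z}" "J \<subseteq> {..<dim_col ?Z}"
    using lt by (auto simp: I_def J_def generic_mat_def)
  have sub: "submatrix ?Z I J = mat t t (\<lambda>(x, y). zvar (i x, j y))"
  proof -
    have "{x. x < dim_row ?Z \<and> x \<in> I} = I" "{y. y < dim_col ?Z \<and> y \<in> J} = J" using IJ by auto
    moreover have "?Z $$ (pick I x, pick J y) = zvar (i x, j y)" if "x < t" "y < t" for x y
      unfolding I_def J_def pick_strict_mono[OF i' that(1)] pick_strict_mono[OF j' that(2)]
      using lt(1)[OF that(1)] lt(2)[OF that(2)] pos(1)[OF that(1)] pos(3)[OF that(2)]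
      by (simp add: generic_mat_def) (simp add: i'_def j'_def)
    ultimately show ?thesis unfolding submatrix_def
      using cards by (intro eq_matI) auto
  qed
  have "det (submatrix ?Z I J) =
      (\<Sum>p | p permutes {0..<t}. signof p * (\<Prod>s = 0..<t. zvar (i s, j (p s))))"
    unfolding sub det_def by (auto intro!: sum.cong prod.cong arg_cong2[where f = "(*)"])
  then show ?thesis using IJ cards unfolding minors_def by (smt (verit) mem_Collect_eq)
qed

section \<open>Straightening\<close>

text \<open>The least point that is moved goes up, and its preimage lies above it and goes down to it.\<close>

lemma permutation_inversion:
  assumes p: "p permutes {0..<t::nat}" and "p \<noteq> id"
  obtains s s' where "s < s'" "s' < t" "p s' < p s"
proof -
  have "\<exists>s. p s \<noteq> s" using \<open>p \<noteq> id\<close> by auto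
  define s where "s = (LEAST s. p s \<noteq> s)"
  have s: "p s \<noteq> s" unfolding s_def using \<open>\<exists>s. p s \<noteq> s\<close> by (rule LeastI_ex)
  have below: "p x = x" if "x < s" for x using not_less_Least that unfolding s_def by blast
  have inj: "inj p" using p by (rule permutes_inj)
  obtain s' where s': "p s' = s" using permutes_surj[OF p] by (metis surj_def)
  have "s < s'" using s s' below by (metis nat_neq_iff)
  moreover have "s' < t" using p s' s by (metis atLeastLessThan_iff permutes_def)
  moreover have "s < p s" using s below inj by (metis injD nat_neq_iff)
  ultimately show thesis using that s' by auto
qed

text \<open>Undoing an inversion strictly increases the sum, so no permutation except the identity attains
  the maximum.\<close>

lemma rearrangement_strict:
  fixes i j :: "nat \<Rightarrow> nat"
  assumes i: "strict_mono_on {..<t} i" and j: "strict_mono_on {..<t} j"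
    and p: "p permutes {0..<t}" and "p \<noteq> id"
  shows "(\<Sum>s<t. i s * j (p s)) < (\<Sum>s<t. i s * j s)"
proof -
  let ?W = "\<lambda>p. \<Sum>s<t. i s * j (p s)"
  have improve: "\<exists>q. q permutes {0..<t} \<and> ?W p < ?W q" if p: "p permutes {0..<t}" "p \<noteq> id" for p
  proof -
    obtain s s' where s: "s < s'" "s' < t" "p s' < p s" using permutation_inversion[OF p] .
    \<comment> \<open>\<open>q\<close> takes the values of \<open>p\<close>, with the two at the inversion exchanged\<close>
    define q where "q = p \<circ> Transposition.transpose s s'"
    have q: "q permutes {0..<t}" unfolding q_def
      using s by (intro permutes_compose[OF permutes_swap_id p(1)]) auto
    have split: "?W f = i s * j (f s) + i s' * j (f s') + (\<Sum>x\<in>{..<t} - {s, s'}. i x * j (f x))"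
      for f
      using s by (subst sum.subset_diff[of "{s, s'}"]) auto
    have rest: "(\<Sum>x\<in>{..<t} - {s, s'}. i x * j (q x)) = (\<Sum>x\<in>{..<t} - {s, s'}. i x * j (p x))"
      by (rule sum.cong) (auto simp: q_def Transposition.transpose_def)
    have "p s < t" using p(1) s by (metis atLeastLessThan_iff le0 less_trans permutes_in_image)
    then have "i s < i s'" "j (p s') < j (p s)"
      using i j s by (auto simp: strict_mono_on_def)
    then obtain e d where "i s' = i s + e" "e > 0" "j (p s) = j (p s') + d" "d > 0"
      by (metis less_imp_add_positive)
    then have "i s * j (p s) + i s' * j (p s') < i s * j (p s') + i s' * j (p s)"
      by (simp add: algebra_simps)
    then have "?W p < ?W q" unfolding split[of p] split[of q] rest by (simp add: q_def)
    with q show ?thesis by blast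
  qed
  let ?M = "{p. p permutes {0..<t}}"
  have fin: "finite (?W ` ?M)" by (simp add: finite_permutations)
  have "Max (?W ` ?M) \<in> ?W ` ?M"
    using fin permutes_id[of "{0..<t}"] by (intro Max_in) blast+
  then obtain q where q: "q permutes {0..<t}" "?W q = Max (?W ` ?M)" by auto
  have max: "?W q' \<le> ?W q" if "q' permutes {0..<t}" for q'
    unfolding q(2) using fin that by (intro Max_ge) auto
  have "q = id" using improve[OF q(1)] max by (metis not_less)
  moreover obtain p' where "p' permutes {0..<t}" "?W p < ?W p'"
    using improve[OF p \<open>p \<noteq> id\<close>] by blast
  ultimately show ?thesis using max[of p'] by simp
qed

text \<open>The degree of a monomial when the variable \<open>v\<close> is given degree \<open>w v\<close>.\<close>

definition weight :: "('v \<Rightarrow> nat) \<Rightarrow> ('v \<Rightarrow>\<^sub>0 nat) \<Rightarrow> nat" where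
  "weight w a = (\<Sum>v\<in>Poly_Mapping.keys a. Poly_Mapping.lookup a v * w v)"

lemma weight_superset:
  assumes "finite F" "Poly_Mapping.keys a \<subseteq> F"
  shows "weight w a = (\<Sum>v\<in>F. Poly_Mapping.lookup a v * w v)"
  unfolding weight_def using assms by (intro sum.mono_neutral_left) (auto simp: in_keys_iff)

lemma weight_add: "weight w (a + b) = weight w a + weight w b"
proof -
  let ?F = "Poly_Mapping.keys a \<union> Poly_Mapping.keys b"
  have "weight w (a + b) = (\<Sum>v\<in>?F. Poly_Mapping.lookup (a + b) v * w v)"
    by (intro weight_superset Poly_Mapping.keys_add) simp
  then show ?thesis
    by (simp add: weight_superset[of ?F] lookup_add distrib_right sum.distrib)
qed

lemma weight_zero: "weight w 0 = 0"
  by (simp add: weight_def)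

lemma weight_sum: "weight w (\<Sum>x\<in>X. f x) = (\<Sum>x\<in>X. weight w (f x))"
  by (induction X rule: infinite_finite_induct) (simp_all add: weight_add weight_zero)

lemma weight_single: "weight w (Poly_Mapping.single v e) = e * w v"
  by (simp add: weight_def)

lemma lookup_le_weight_one: "Poly_Mapping.lookup a v \<le> weight (\<lambda>_. 1) a"
proof (cases "v \<in> Poly_Mapping.keys a")
  case True
  then show ?thesis unfolding weight_def by (simp add: member_le_sum)
qed (simp add: in_keys_iff)

lemma prod_zvar:
  "(\<Prod>s\<in>X. zvar (v s)) = Poly_Mapping.single (\<Sum>s\<in>X. Poly_Mapping.single (v s) 1) (1::'k::field)"
  by (induction X rule: infinite_finite_induct) (auto simp: zvar_def mult_single)

lemma signof_in_polys_in: "signof p \<in> polys_in V"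
  by (auto simp: sign_def intro: polys_in_one polys_in_uminus)

lemma keys_signof_mult: "Poly_Mapping.keys (signof p * f) \<subseteq> Poly_Mapping.keys (f :: 'k::field entry_poly)"
  using keys_uminus_subset[of f] by (auto simp: sign_def)

text \<open>If the support of a monomial contains the main diagonal of a \<open>t\<close>-minor, the minor can be used to
  replace that diagonal by the other terms of its expansion. When the variable in position
  \<open>(i, j)\<close> has weight \<open>i * j\<close>, all of these are lighter by the rearrangement inequality, so the
  process ends with monomials that contain no such diagonal. Minors are homogeneous, so the degree
  is kept.\<close>

lemma straightening:
  assumes "Poly_Mapping.keys a \<subseteq> grid m n"
  shows "\<exists>g :: 'k::field entry_poly. Poly_Mapping.single a 1 - g \<in> det_ideal t m n \<and>
    Poly_Mapping.keys g \<subseteq> {b. Poly_Mapping.keys b \<subseteq> grid m n \<and>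
      weight (\<lambda>_. 1) b = weight (\<lambda>_. 1) a \<and> \<not> has_diagonal t (Poly_Mapping.keys b)}"
  using assms
proof (induction "weight (\<lambda>(i, j). i * j) a" arbitrary: a rule: less_induct)
  case (less a)
  let ?w = "\<lambda>(i, j). i * j"
  define N where "N = {b. Poly_Mapping.keys b \<subseteq> grid m n \<and>
    weight (\<lambda>_. 1) b = weight (\<lambda>_. 1) a \<and> \<not> has_diagonal t (Poly_Mapping.keys b)}"
  have "\<exists>g :: 'k entry_poly. Poly_Mapping.single a 1 - g \<in> det_ideal t m n \<and> Poly_Mapping.keys g \<subseteq> N"
  proof (cases "has_diagonal t (Poly_Mapping.keys a)")
    case False
    then show ?thesis using less.prems
      by (intro exI[of _ "Poly_Mapping.single a 1"])
         (simp add: zero_in_det_ideal N_def)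
  next
    case True
    then obtain i j where i: "strict_mono_on {..<t} i" and j: "strict_mono_on {..<t} j"
      and ij: "\<And>s. s < t \<Longrightarrow> (i s, j s) \<in> Poly_Mapping.keys a"
      by (auto simp: has_diagonal_def)
    have ij_grid: "(i s, j s) \<in> grid m n" if "s < t" for s using ij[OF that] less.prems by blast
    define d where "d p = (\<Sum>s = 0..<t. Poly_Mapping.single (i s, j (p s)) (1::nat))" for p
    have d_le: "Poly_Mapping.lookup (d id) v \<le> Poly_Mapping.lookup a v" for v
    proof (cases "\<exists>s<t. (i s, j s) = v")
      case True
      then obtain s0 where s0: "s0 < t" "v = (i s0, j s0)" by blast
      have "Poly_Mapping.lookup (d id) v = (\<Sum>s = 0..<t. if s = s0 then 1 else 0)"
        unfolding d_def lookup_sum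
        using s0 strict_mono_on_imp_inj_on[OF i]
        by (intro sum.cong refl) (auto simp: lookup_single when_def inj_on_def)
      also have "\<dots> = 1" using s0 by simp
      also have "\<dots> \<le> Poly_Mapping.lookup a v" using ij[OF s0(1)] s0(2) by (simp add: in_keys_iff)
      finally show ?thesis .
    next
      case False
      then have "Poly_Mapping.lookup (d id) v = 0"
        unfolding d_def lookup_sum by (intro sum.neutral) (auto simp: lookup_single when_def)
      then show ?thesis by simp
    qed
    \<comment> \<open>\<open>d id\<close> is squarefree, as \<open>i\<close> is injective, so it divides \<open>a\<close>\<close>
    define c where "c = a - d id"
    have a: "a = c + d id"
      by (rule poly_mapping_eqI) (simp add: c_def lookup_add lookup_minus d_le)
    have c_grid: "Poly_Mapping.keys c \<subseteq> grid m n"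
    proof -
      have "Poly_Mapping.keys c \<subseteq> Poly_Mapping.keys a" by (auto simp: c_def in_keys_iff lookup_minus)
      then show ?thesis using less.prems by blast
    qed
    let ?S = "{p. p permutes {0..<t}}"
    have d_grid: "Poly_Mapping.keys (d p) \<subseteq> grid m n" if "p permutes {0..<t}" for p
      unfolding d_def
    proof (rule keys_sum_subset)
      fix s assume "s \<in> {0..<t}"
      then have "p s < t" "s < t" using permutes_in_image[OF that] by auto
      then show "Poly_Mapping.keys (Poly_Mapping.single (i s, j (p s)) (1::nat)) \<subseteq> grid m n"
        using ij_grid[of s] ij_grid[of "p s"] by auto
    qed
    have w: "weight ?w (d p) = (\<Sum>s<t. i s * j (p s))" for p
      by (simp add: d_def weight_sum weight_single lessThan_atLeast0)
    have deg: "weight (\<lambda>_. 1) (c + d p) = weight (\<lambda>_. 1) a" for p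
      by (simp add: a weight_add d_def weight_sum weight_single)
    have "\<exists>g :: 'k entry_poly. Poly_Mapping.single (c + d p) 1 - g \<in> det_ideal t m n \<and>
        Poly_Mapping.keys g \<subseteq> N"
      if p: "p \<in> ?S - {id}" for p
    proof -
      have "weight ?w (c + d p) < weight ?w a"
        using rearrangement_strict[OF i j, of p] p by (simp add: a weight_add w)
      moreover have "Poly_Mapping.keys (c + d p) \<subseteq> grid m n"
        using Poly_Mapping.keys_add[of c "d p"] c_grid d_grid[of p] p by blast
      ultimately show ?thesis using less.hyps[of "c + d p"] deg by (simp add: N_def)
    qed
    then have "\<forall>p\<in>?S - {id}. \<exists>g :: 'k entry_poly. Poly_Mapping.single (c + d p) 1 - g \<in> det_ideal t m n \<and>
        Poly_Mapping.keys g \<subseteq> N" by blast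
    from bchoice[OF this] obtain g :: "(nat \<Rightarrow> nat) \<Rightarrow> 'k entry_poly" where
      g: "\<And>p. p \<in> ?S - {id} \<Longrightarrow> Poly_Mapping.single (c + d p) 1 - g p \<in> det_ideal t m n"
      and g_keys: "\<And>p. p \<in> ?S - {id} \<Longrightarrow> Poly_Mapping.keys (g p) \<subseteq> N"
      by blast
    define h where "h = - (\<Sum>p\<in>?S - {id}. signof p * g p)"
    define M where "M = (\<Sum>p\<in>?S. signof p * (\<Prod>s = 0..<t. zvar (i s, j (p s)) :: 'k entry_poly))"
    have "M \<in> minors t (generic_mat m n)"
      unfolding M_def by (rule minor_of_diagonal[OF i j ij_grid])
    then have cM: "Poly_Mapping.single c 1 * M \<in> det_ideal t m n"
      unfolding det_ideal_def by (intro mult_in_ideal_gen polys_in_single c_grid)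
    have "Poly_Mapping.single c 1 * M = (\<Sum>p\<in>?S. signof p * Poly_Mapping.single (c + d p) 1)"
      by (simp add: M_def prod_zvar d_def mult_single sum_distrib_left mult.left_commute)
    also have "\<dots> = Poly_Mapping.single a 1 + (\<Sum>p\<in>?S - {id}. signof p * Poly_Mapping.single (c + d p) 1)"
      by (subst sum.remove[of _ id]) (auto simp: finite_permutations permutes_id a)
    finally have "Poly_Mapping.single a 1 - h = Poly_Mapping.single c 1 * M
        + (\<Sum>p\<in>?S - {id}. (- signof p) * (Poly_Mapping.single (c + d p) 1 - g p))"
      by (simp add: h_def algebra_simps sum.distrib sum_subtractf sum_negf)
    also have "\<dots> \<in> det_ideal t m n"
      by (intro det_ideal_add cM det_ideal_sum det_ideal_mult g polys_in_uminus signof_in_polys_in)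
    finally have "Poly_Mapping.single a 1 - h \<in> det_ideal t m n" .
    moreover have "Poly_Mapping.keys h \<subseteq> N"
      unfolding h_def
      by (rule order.trans[OF keys_uminus_subset keys_sum_subset])
         (rule order.trans[OF keys_signof_mult g_keys])
    ultimately show ?thesis by blast
  qed
  then show ?case by (simp only: N_def)
qed

section \<open>Dependence by counting monomials\<close>

lemma det_zero_row:
  assumes M: "M \<in> carrier_mat N N" and "s < N" and zero: "\<And>y. y < N \<Longrightarrow> M $$ (s, y) = 0"
  shows "det M = 0"
  unfolding det_def'[OF M]
proof (rule sum.neutral, rule ballI)
  fix p assume "p \<in> {p. p permutes {0..<N}}"
  then have "p s < N" using \<open>s < N\<close> permutes_in_image[of p "{0..<N}" s] by simp
  then have "(\<Prod>s = 0..<N. M $$ (s, p s)) = 0"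
    using zero \<open>s < N\<close> by (intro prod_zero bexI[of _ s]) auto
  then show "signof p * (\<Prod>s = 0..<N. M $$ (s, p s)) = 0" by simp
qed

text \<open>Padded with zero rows, the coefficient matrix is square and has determinant zero, hence a
  nonzero kernel vector.\<close>

lemma homogeneous_system_solution:
  fixes G :: "'a \<Rightarrow> 'b \<Rightarrow> 'k::field"
  assumes A: "finite A" and B: "finite B" and lt: "card B < card A"
  shows "\<exists>c. (\<exists>a\<in>A. c a \<noteq> 0) \<and> (\<forall>b\<in>B. (\<Sum>a\<in>A. c a * G a b) = 0)"
proof -
  define N where "N = card A"
  obtain h where h: "bij_betw h {0..<N} A"
    unfolding N_def using ex_bij_betw_nat_finite[OF A] by blast
  obtain h' where h': "bij_betw h' {0..<card B} B" using ex_bij_betw_nat_finite[OF B] by blast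
  define M where "M = mat N N (\<lambda>(x, y). if x < card B then G (h y) (h' x) else 0)"
  have M: "M \<in> carrier_mat N N" by (simp add: M_def)
  have "det M = 0"
    by (rule det_zero_row[OF M, of "N - 1"]) (use lt in \<open>auto simp: M_def N_def\<close>)
  then obtain v where v: "v \<in> carrier_vec N" "v \<noteq> 0\<^sub>v N" "M *\<^sub>v v = 0\<^sub>v N"
    using det_0_iff_vec_prod_zero_field[OF M] by blast
  define c where "c a = v $ (the_inv_into {0..<N} h a)" for a
  have ch: "c (h y) = v $ y" if "y < N" for y
    using h that by (simp add: c_def bij_betw_def the_inv_into_f_f)
  have "\<exists>y<N. v $ y \<noteq> 0" using v(1,2) by (metis carrier_vecD eq_vecI index_zero_vec)
  then have "\<exists>a\<in>A. c a \<noteq> 0" using ch h by (metis atLeastLessThan_iff bij_betwE le0)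
  moreover have "(\<Sum>a\<in>A. c a * G a b) = 0" if "b \<in> B" for b
  proof -
    have "b \<in> h' ` {0..<card B}" using h' that by (simp add: bij_betw_def)
    then obtain x where x: "x < card B" "b = h' x" by auto
    have "(\<Sum>a\<in>A. c a * G a b) = (\<Sum>y = 0..<N. c (h y) * G (h y) b)"
      by (rule sum.reindex_bij_betw[OF h, symmetric])
    also have "\<dots> = (\<Sum>y = 0..<N. M $$ (x, y) * v $ y)"
      using x lt by (intro sum.cong) (auto simp: ch M_def N_def)
    also have "\<dots> = (M *\<^sub>v v) $ x"
      using x lt v(1) M by (simp add: scalar_prod_def N_def)
    also have "\<dots> = 0" unfolding v(3) using x lt by (simp add: N_def)
    finally show ?thesis .
  qed
  ultimately show ?thesis by blast
qed

lemma lookup_const_mult: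
  "Poly_Mapping.lookup (Poly_Mapping.single 0 c * p :: 'k::field entry_poly) b = c * Poly_Mapping.lookup p b"
  unfolding mult_map_scale_conv_mult[symmetric]
  by (simp add: Poly_Mapping.map.rep_eq when_def)

text \<open>More monomials than there are normal forms to choose from: a linear relation between the normal
  forms becomes, with the same coefficients, an element of the ideal.\<close>

lemma ideal_element_from_normal_forms:
  fixes g :: "((nat \<times> nat) \<Rightarrow>\<^sub>0 nat) \<Rightarrow> 'k::field entry_poly"
  assumes A: "finite A" and B: "finite B" and lt: "card B < card A"
    and g: "\<And>a. a \<in> A \<Longrightarrow> Poly_Mapping.single a 1 - g a \<in> det_ideal t m n"
    and keys: "\<And>a. a \<in> A \<Longrightarrow> Poly_Mapping.keys (g a) \<subseteq> B"
  shows "\<exists>f \<in> det_ideal t m n. f \<noteq> (0 :: 'k entry_poly) \<and> Poly_Mapping.keys f \<subseteq> A"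
proof -
  obtain c where c: "\<exists>a\<in>A. c a \<noteq> 0"
    and eq: "\<And>b. b \<in> B \<Longrightarrow> (\<Sum>a\<in>A. c a * Poly_Mapping.lookup (g a) b) = 0"
    using homogeneous_system_solution[OF A B lt, of "\<lambda>a. Poly_Mapping.lookup (g a)"] by blast
  define f where "f = (\<Sum>a\<in>A. Poly_Mapping.single a (c a))"
  have lookup_f: "Poly_Mapping.lookup f a = c a" if "a \<in> A" for a
    using A that by (simp add: f_def lookup_sum lookup_single when_def)
  have cancel: "(\<Sum>a\<in>A. Poly_Mapping.single 0 (c a) * g a) = 0"
  proof (rule poly_mapping_eqI)
    fix b
    have "(\<Sum>a\<in>A. c a * Poly_Mapping.lookup (g a) b) = 0"
    proof (cases "b \<in> B")
      case False
      then have "Poly_Mapping.lookup (g a) b = 0" if "a \<in> A" for a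
        using keys[OF that] by (auto simp: in_keys_iff)
      then show ?thesis by simp
    qed (rule eq)
    then show "Poly_Mapping.lookup (\<Sum>a\<in>A. Poly_Mapping.single 0 (c a) * g a) b = Poly_Mapping.lookup 0 b"
      by (simp add: lookup_sum lookup_const_mult)
  qed
  have "f = (\<Sum>a\<in>A. Poly_Mapping.single 0 (c a) * (Poly_Mapping.single a 1 - g a))"
    using cancel by (simp add: f_def right_diff_distrib sum_subtractf mult_single)
  also have "\<dots> \<in> det_ideal t m n"
    by (intro det_ideal_sum det_ideal_mult g polys_in_single) auto
  finally have "f \<in> det_ideal t m n" .
  moreover have "f \<noteq> 0" using c lookup_f by auto
  moreover have "Poly_Mapping.keys f \<subseteq> A"
    unfolding f_def by (rule keys_sum_subset) auto
  ultimately show ?thesis by blast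
qed

definition monomials_below :: "'v set \<Rightarrow> nat \<Rightarrow> ('v \<Rightarrow>\<^sub>0 nat) set" where
  "monomials_below S D = {a. Poly_Mapping.keys a \<subseteq> S \<and> (\<forall>v. Poly_Mapping.lookup a v < D)}"

lemma card_monomials_below:
  assumes "finite S" "0 < D"
  shows "finite (monomials_below S D)" "card (monomials_below S D) = D ^ card S"
proof -
  let ?F = "\<lambda>a. restrict (Poly_Mapping.lookup a) S"
  have "bij_betw ?F (monomials_below S D) (S \<rightarrow>\<^sub>E {..<D})"
  proof (rule bij_betw_imageI)
    show "inj_on ?F (monomials_below S D)"
    proof (rule inj_onI, rule poly_mapping_eqI)
      fix a b v assume *: "a \<in> monomials_below S D" "b \<in> monomials_below S D" "?F a = ?F b"
      show "Poly_Mapping.lookup a v = Poly_Mapping.lookup b v"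
      proof (cases "v \<in> S")
        case True
        then show ?thesis using fun_cong[OF *(3), of v] by simp
      next
        case False
        then have "v \<notin> Poly_Mapping.keys a" "v \<notin> Poly_Mapping.keys b"
          using *(1,2) by (auto simp: monomials_below_def)
        then show ?thesis by (simp add: in_keys_iff)
      qed
    qed
    show "?F ` monomials_below S D = S \<rightarrow>\<^sub>E {..<D}"
    proof (intro equalityI subsetI)
      fix f assume f: "f \<in> S \<rightarrow>\<^sub>E {..<D}"
      define a where "a = (\<Sum>v\<in>S. Poly_Mapping.single v (f v))"
      have a: "Poly_Mapping.lookup a v = (if v \<in> S then f v else 0)" for v
        using assms(1) by (simp add: a_def lookup_sum lookup_single when_def)
      then have "a \<in> monomials_below S D"
        using f assms(2) by (auto simp: monomials_below_def in_keys_iff PiE_iff split: if_splits)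
      moreover have "?F a = f" using f a by (auto simp: PiE_iff extensional_def)
      ultimately show "f \<in> ?F ` monomials_below S D" by blast
    qed (auto simp: monomials_below_def)
  qed
  moreover have "finite (S \<rightarrow>\<^sub>E {..<D})" "card (S \<rightarrow>\<^sub>E {..<D}) = D ^ card S"
    using assms by (auto simp: finite_PiE card_PiE)
  ultimately show "finite (monomials_below S D)" "card (monomials_below S D) = D ^ card S"
    by (auto simp: bij_betw_finite bij_betw_same_card)
qed

text \<open>Growth comparison. There are \<open>D ^ card \<Omega>\<close> monomials in the variables of \<open>\<Omega>\<close> with all exponents
  below \<open>D\<close>. Their normal forms have degree \<open>O(D)\<close> and are supported on one of finitely many
  sets, each with fewer than \<open>card \<Omega>\<close> cells, so that only \<open>O(D ^ (card \<Omega> - 1))\<close> monomials occur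
  in them. For large \<open>D\<close> the former number wins.\<close>

lemma dependent_if_larger_than_diagonal_free:
  assumes "0 < t" and \<Omega>: "\<Omega> \<subseteq> grid m n"
    and small: "\<And>S. S \<subseteq> grid m n \<Longrightarrow> \<not> has_diagonal t S \<Longrightarrow> card S < card \<Omega>"
  shows "\<exists>f \<in> det_ideal t m n \<inter> polys_in \<Omega>. f \<noteq> (0 :: 'k::field entry_poly)"
proof (cases "card \<Omega>")
  case 0
  have "\<not> has_diagonal t {}" using \<open>0 < t\<close> by (auto simp: has_diagonal_def)
  then show ?thesis using small[of "{}"] 0 by simp
next
  case (Suc s)
  \<comment> \<open>\<open>K\<close> absorbs the number of supports and the factor \<open>(s + 2) ^ s\<close> lost in passing from \<open>D\<close> to the degree bound \<open>E\<close>\<close>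
  define K :: nat where "K = 2 ^ (m * n) * (s + 2) ^ s"
  define D where "D = K + 1"
  define E where "E = (s + 2) * D"
  have fin: "finite \<Omega>" using \<Omega> by (rule finite_subset) auto
  define A where "A = monomials_below \<Omega> D"
  define T where "T = {S. S \<subseteq> grid m n \<and> \<not> has_diagonal t S}"
  define B where "B = (\<Union>S\<in>T. monomials_below S E)"
  have pos: "0 < D" "0 < E" by (simp_all add: D_def E_def)
  have T: "finite T" "card T \<le> 2 ^ (m * n)"
  proof -
    have "T \<subseteq> Pow (grid m n)" by (auto simp: T_def)
    then show "finite T" by (rule finite_subset) auto
    show "card T \<le> 2 ^ (m * n)"
      using card_mono[OF _ \<open>T \<subseteq> Pow (grid m n)\<close>] by (simp add: card_Pow card_cartesian_product)
  qed
  have finT: "finite S" if "S \<in> T" for S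
  proof (rule finite_subset)
    show "S \<subseteq> grid m n" using that by (simp add: T_def)
  qed simp
  have A: "finite A" "card A = D ^ Suc s"
    using card_monomials_below[OF fin pos(1)] Suc by (auto simp: A_def)
  have B: "finite B" unfolding B_def
    using T(1) finT by (intro finite_UN_I card_monomials_below(1) pos(2))
  have "card B \<le> (\<Sum>S\<in>T. card (monomials_below S E))"
    unfolding B_def by (rule card_UN_le[OF T(1)])
  also have "\<dots> \<le> (\<Sum>S\<in>T. E ^ s)"
  proof (rule sum_mono)
    fix S assume S: "S \<in> T"
    then have "card S \<le> s" using small[of S] Suc by (auto simp: T_def)
    show "card (monomials_below S E) \<le> E ^ s"
      using card_monomials_below(2)[OF finT[OF S] pos(2)] pos(2)
        power_increasing[OF \<open>card S \<le> s\<close>, of E]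
      by simp
  qed
  also have "\<dots> \<le> 2 ^ (m * n) * E ^ s" using T(2) by simp
  also have "\<dots> = K * D ^ s" by (simp only: K_def E_def power_mult_distrib mult.assoc)
  also have "\<dots> < D * D ^ s" using pos(1) by (intro mult_strict_right_mono) (simp_all add: D_def)
  finally have less: "card B < card A" using A(2) by (simp only: power_Suc)
  have "\<exists>g :: 'k entry_poly. Poly_Mapping.single a 1 - g \<in> det_ideal t m n \<and> Poly_Mapping.keys g \<subseteq> B"
    if a: "a \<in> A" for a
  proof -
    have keys_a: "Poly_Mapping.keys a \<subseteq> \<Omega>" using a by (simp add: A_def monomials_below_def)
    have exps: "Poly_Mapping.lookup a v \<le> D" for v
      using a unfolding A_def monomials_below_def by (blast intro: less_imp_le)
    have "weight (\<lambda>_. 1) a = (\<Sum>v\<in>\<Omega>. Poly_Mapping.lookup a v)"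
      by (simp add: weight_superset[OF fin keys_a])
    also have "\<dots> \<le> (\<Sum>v\<in>\<Omega>. D)" by (rule sum_mono) (rule exps)
    also have "\<dots> = Suc s * D" using Suc by simp
    also have "\<dots> < E" using pos(1) unfolding E_def by (intro mult_strict_right_mono) simp_all
    finally have deg: "weight (\<lambda>_. 1) a < E" .
    have "Poly_Mapping.keys a \<subseteq> grid m n" using keys_a \<Omega> by (rule order.trans)
    from straightening[OF this, where ?'k = 'k, of t]
    obtain g :: "'k entry_poly" where "Poly_Mapping.single a 1 - g \<in> det_ideal t m n"
      and g: "Poly_Mapping.keys g \<subseteq> {b. Poly_Mapping.keys b \<subseteq> grid m n \<and>
        weight (\<lambda>_. 1) b = weight (\<lambda>_. 1) a \<and> \<not> has_diagonal t (Poly_Mapping.keys b)}"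
      by (elim exE conjE)
    moreover have "Poly_Mapping.keys g \<subseteq> B"
    proof
      fix b assume "b \<in> Poly_Mapping.keys g"
      then have "Poly_Mapping.keys b \<in> T" "weight (\<lambda>_. 1) b < E" using g deg by (auto simp: T_def)
      moreover have "b \<in> monomials_below (Poly_Mapping.keys b) E"
        unfolding monomials_below_def
        using le_less_trans[OF lookup_le_weight_one \<open>weight (\<lambda>_. 1) b < E\<close>] by simp
      ultimately show "b \<in> B" unfolding B_def by blast
    qed
    ultimately show ?thesis by blast
  qed
  then have "\<forall>a\<in>A. \<exists>g :: 'k entry_poly.
      Poly_Mapping.single a 1 - g \<in> det_ideal t m n \<and> Poly_Mapping.keys g \<subseteq> B" by blast
  from bchoice[OF this] obtain g :: "_ \<Rightarrow> 'k entry_poly"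
    where "\<And>a. a \<in> A \<Longrightarrow> Poly_Mapping.single a 1 - g a \<in> det_ideal t m n"
      and "\<And>a. a \<in> A \<Longrightarrow> Poly_Mapping.keys (g a) \<subseteq> B" by blast
  from ideal_element_from_normal_forms[OF A(1) B less this]
  obtain f :: "'k entry_poly" where "f \<in> det_ideal t m n" "f \<noteq> 0" "Poly_Mapping.keys f \<subseteq> A" by blast
  moreover have "f \<in> polys_in \<Omega>"
    using \<open>Poly_Mapping.keys f \<subseteq> A\<close> unfolding polys_in_iff A_def monomials_below_def by (intro ballI) blast
  ultimately show ?thesis by blast
qed

section \<open>Substitutions that kill the minors\<close>

definition subst_monomial :: "('v \<Rightarrow> 'a::comm_ring_1) \<Rightarrow> ('v \<Rightarrow>\<^sub>0 nat) \<Rightarrow> 'a" where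
  "subst_monomial x a = (\<Prod>v\<in>Poly_Mapping.keys a. x v ^ Poly_Mapping.lookup a v)"

lemma subst_monomial_superset:
  assumes "finite F" "Poly_Mapping.keys a \<subseteq> F"
  shows "subst_monomial x a = (\<Prod>v\<in>F. x v ^ Poly_Mapping.lookup a v)"
  unfolding subst_monomial_def
  using assms by (intro prod.mono_neutral_left) (auto simp: in_keys_iff)

lemma subst_monomial_add: "subst_monomial x (a + b) = subst_monomial x a * subst_monomial x b"
proof -
  let ?F = "Poly_Mapping.keys a \<union> Poly_Mapping.keys b"
  have "subst_monomial x (a + b) = (\<Prod>v\<in>?F. x v ^ Poly_Mapping.lookup (a + b) v)"
    by (intro subst_monomial_superset Poly_Mapping.keys_add) simp
  then show ?thesis
    by (simp add: subst_monomial_superset[of ?F] lookup_add power_add prod.distrib)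
qed

text \<open>The homomorphism of \<open>\<k>\<close>-algebras that sends the variable \<open>v\<close> to \<open>x v\<close>.\<close>

definition subst_poly :: "(nat \<times> nat \<Rightarrow> 'k poly) \<Rightarrow> 'k::field entry_poly \<Rightarrow> 'k poly" where
  "subst_poly x f = (\<Sum>a\<in>Poly_Mapping.keys f. [:Poly_Mapping.lookup f a:] * subst_monomial x a)"

lemma subst_poly_superset:
  assumes "finite F" "Poly_Mapping.keys f \<subseteq> F"
  shows "subst_poly x f = (\<Sum>a\<in>F. [:Poly_Mapping.lookup f a:] * subst_monomial x a)"
  unfolding subst_poly_def
  using assms by (intro sum.mono_neutral_left) (auto simp: in_keys_iff)

lemma subst_poly_add: "subst_poly x (f + g) = subst_poly x f + subst_poly x g"
proof -
  let ?F = "Poly_Mapping.keys f \<union> Poly_Mapping.keys g"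
  have "subst_poly x (f + g) = (\<Sum>a\<in>?F. [:Poly_Mapping.lookup (f + g) a:] * subst_monomial x a)"
    by (intro subst_poly_superset Poly_Mapping.keys_add) simp
  also have "\<dots> = (\<Sum>a\<in>?F. [:Poly_Mapping.lookup f a:] * subst_monomial x a
      + [:Poly_Mapping.lookup g a:] * subst_monomial x a)"
    by (intro sum.cong refl) (simp add: lookup_add smult_add_left)
  finally show ?thesis by (simp add: subst_poly_superset[of ?F] sum.distrib)
qed

lemma subst_poly_zero: "subst_poly x 0 = 0"
  by (simp add: subst_poly_def)

lemma subst_poly_sum: "subst_poly x (\<Sum>i\<in>X. f i) = (\<Sum>i\<in>X. subst_poly x (f i))"
  by (induction X rule: infinite_finite_induct) (simp_all add: subst_poly_add subst_poly_zero)

lemma subst_poly_single: "subst_poly x (Poly_Mapping.single a c) = [:c:] * subst_monomial x a"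
  by (simp add: subst_poly_superset[of "{a}"])

lemma sum_of_terms: "f = (\<Sum>a\<in>Poly_Mapping.keys f. Poly_Mapping.single a (Poly_Mapping.lookup f a))"
  by (rule poly_mapping_eqI) (simp add: lookup_sum lookup_single when_def in_keys_iff)

lemma subst_poly_mult: "subst_poly x (f * g) = subst_poly x f * subst_poly x g"
proof -
  have "f * g = (\<Sum>a\<in>Poly_Mapping.keys f. Poly_Mapping.single a (Poly_Mapping.lookup f a)) *
      (\<Sum>b\<in>Poly_Mapping.keys g. Poly_Mapping.single b (Poly_Mapping.lookup g b))"
    using sum_of_terms[of f] sum_of_terms[of g] by simp
  also have "\<dots> = (\<Sum>a\<in>Poly_Mapping.keys f. \<Sum>b\<in>Poly_Mapping.keys g.
      Poly_Mapping.single (a + b) (Poly_Mapping.lookup f a * Poly_Mapping.lookup g b))"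
    by (simp add: sum_product mult_single)
  finally have "subst_poly x (f * g) = (\<Sum>a\<in>Poly_Mapping.keys f. \<Sum>b\<in>Poly_Mapping.keys g.
      subst_poly x (Poly_Mapping.single (a + b) (Poly_Mapping.lookup f a * Poly_Mapping.lookup g b)))"
    by (simp only: subst_poly_sum)
  also have "\<dots> = (\<Sum>a\<in>Poly_Mapping.keys f. \<Sum>b\<in>Poly_Mapping.keys g.
      ([:Poly_Mapping.lookup f a:] * subst_monomial x a) * ([:Poly_Mapping.lookup g b:] * subst_monomial x b))"
    by (intro sum.cong refl) (simp add: subst_poly_single subst_monomial_add mult_ac)
  also have "\<dots> = subst_poly x f * subst_poly x g" by (simp only: subst_poly_def sum_product)
  finally show ?thesis .
qed

lemma subst_poly_hom: "comm_ring_hom (subst_poly x)"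
proof
  show "subst_poly x 1 = 1"
    unfolding single_one[symmetric] subst_poly_single by (simp add: subst_monomial_def one_pCons)
qed (simp_all add: subst_poly_add subst_poly_mult subst_poly_zero)

lemma subst_poly_zvar: "subst_poly x (zvar v) = x v"
  by (simp add: zvar_def subst_poly_single subst_monomial_def one_pCons[symmetric])

text \<open>The generic matrix is sent to a product of two matrices with inner dimension \<open>r\<close>. Padded with
  zeros to inner dimension \<open>r + 1\<close>, the factors of an \<open>(r + 1)\<close>-minor are square, and the second
  one has a zero row.\<close>

lemma subst_poly_det_ideal_zero:
  fixes x :: "nat \<times> nat \<Rightarrow> 'k::field poly"
  assumes x: "\<And>i j. x (i, j) = (\<Sum>k = 1..r. y i k * z k j)"
    and f: "f \<in> det_ideal (r + 1) m n"
  shows "subst_poly x f = 0"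
proof -
  interpret comm_ring_hom "subst_poly x" by (rule subst_poly_hom)
  let ?Z = "generic_mat m n :: 'k entry_poly mat"
  have minor: "subst_poly x (det (submatrix ?Z I J)) = 0"
    if IJ: "I \<subseteq> {..<m}" "J \<subseteq> {..<n}" "card I = r + 1" "card J = r + 1" for I J
  proof -
    define A where "A = mat (r + 1) (r + 1) (\<lambda>(s, k). if k < r then y (pick I s + 1) (k + 1) else 0)"
    define B where "B = mat (r + 1) (r + 1) (\<lambda>(k, s). if k < r then z (k + 1) (pick J s + 1) else 0)"
    have carr: "A \<in> carrier_mat (r + 1) (r + 1)" "B \<in> carrier_mat (r + 1) (r + 1)"
      by (simp_all add: A_def B_def)
    have eqs: "{i. i < dim_row ?Z \<and> i \<in> I} = I" "{j. j < dim_col ?Z \<and> j \<in> J} = J"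
      using IJ by (auto simp: generic_mat_def)
    have "map_mat (subst_poly x) (submatrix ?Z I J) = A * B"
    proof (rule eq_matI)
      fix s t assume "s < dim_row (A * B)" "t < dim_col (A * B)"
      then have st: "s < r + 1" "t < r + 1" using carr by auto
      have "pick I s < m" "pick J t < n"
        using pick_in_set_le[of s I] pick_in_set_le[of t J] st IJ by auto
      then have "map_mat (subst_poly x) (submatrix ?Z I J) $$ (s, t) = x (pick I s + 1, pick J t + 1)"
        using st IJ eqs
        by (simp add: submatrix_def) (simp add: generic_mat_def subst_poly_zvar)
      also have "\<dots> = (\<Sum>k = 0..<r. y (pick I s + 1) (k + 1) * z (k + 1) (pick J t + 1))"
        unfolding x by (rule sum.reindex_bij_witness[of _ "\<lambda>k. k + 1" "\<lambda>k. k - 1"]) auto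
      also have "\<dots> = (\<Sum>k = 0..<r + 1. A $$ (s, k) * B $$ (k, t))"
        using st by (simp add: A_def B_def)
      also have "\<dots> = (A * B) $$ (s, t)"
        using st carr by (simp add: scalar_prod_def)
      finally show "map_mat (subst_poly x) (submatrix ?Z I J) $$ (s, t) = (A * B) $$ (s, t)" .
    qed (use carr eqs IJ in \<open>auto simp: dim_submatrix\<close>)
    moreover have "det B = 0"
      by (rule det_zero_row[OF carr(2), of r]) (auto simp: B_def)
    ultimately have "det (map_mat (subst_poly x) (submatrix ?Z I J)) = 0"
      using det_mult[OF carr] by simp
    then show ?thesis by simp
  qed
  obtain F q where "f = (\<Sum>g\<in>F. q g * g)" and F: "F \<subseteq> minors (r + 1) ?Z"
    using f by (auto simp: det_ideal_def ideal_gen_def)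
  then have "subst_poly x f = (\<Sum>g\<in>F. subst_poly x (q g) * subst_poly x g)"
    by (simp add: subst_poly_sum subst_poly_mult)
  also have "\<dots> = 0"
  proof (rule sum.neutral, rule ballI)
    fix g assume "g \<in> F"
    then have "g \<in> minors (r + 1) ?Z" using F by blast
    then have "subst_poly x g = 0"
      using minor unfolding minors_def by (auto simp: generic_mat_def)
    then show "subst_poly x (q g) * subst_poly x g = 0" by simp
  qed
  finally show ?thesis .
qed

section \<open>Separating monomials by weights\<close>

text \<open>The weights are the place values of a positional system: each new coordinate is multiplied by a
  number larger than all values that the previous coordinates can contribute.\<close>

lemma separating_weights:
  fixes X :: "('i \<Rightarrow> nat) set"
  assumes "finite I" "finite X"
  shows "\<exists>p. \<forall>x\<in>X. \<forall>y\<in>X. (\<Sum>i\<in>I. p i * x i) = (\<Sum>i\<in>I. p i * y i) \<longrightarrow> (\<forall>i\<in>I. x i = y i)"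
  using assms(1)
proof (induction I rule: finite_induct)
  case (insert i0 I)
  then obtain p where p: "\<And>x y. x \<in> X \<Longrightarrow> y \<in> X \<Longrightarrow>
      (\<Sum>i\<in>I. p i * x i) = (\<Sum>i\<in>I. p i * y i) \<Longrightarrow> \<forall>i\<in>I. x i = y i" by blast
  define S where "S x = (\<Sum>i\<in>I. p i * x i)" for x
  define M where "M = Suc (sum S X)"
  have S: "S x < M" if "x \<in> X" for x
    using member_le_sum[of x X S] that assms(2) by (simp add: M_def)
  have total: "(\<Sum>i\<in>insert i0 I. (p(i0 := M)) i * x i) = M * x i0 + S x" for x
  proof -
    have "(\<Sum>i\<in>I. (p(i0 := M)) i * x i) = S x"
      unfolding S_def using insert.hyps by (intro sum.cong) auto
    then show ?thesis using insert.hyps by simp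
  qed
  have "\<forall>i\<in>insert i0 I. x i = y i"
    if xy: "x \<in> X" "y \<in> X" and eq: "M * x i0 + S x = M * y i0 + S y" for x y
  proof -
    have "S x = S y" using arg_cong[OF eq, of "\<lambda>c. c mod M"] S xy by simp
    moreover from this have "x i0 = y i0" using eq S[OF xy(1)] by simp
    ultimately show ?thesis using p[OF xy] by (simp add: S_def)
  qed
  then have "\<forall>x\<in>X. \<forall>y\<in>X. M * x i0 + S x = M * y i0 + S y \<longrightarrow> (\<forall>i\<in>insert i0 I. x i = y i)"
    by blast
  then show ?case unfolding total[symmetric] by (rule exI[of _ "p(i0 := M)"])
qed auto

text \<open>As edges between rows and columns, the cells of a chain form a forest, and numbers on the edges
  of a forest are determined by their sums at the vertices. Concretely, at the first cell where
  \<open>f\<close> and \<open>g\<close> differ, equal row sums and equal column sums force a later difference in the same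
  row and one in the same column; but these two cells are not comparable.\<close>

lemma antidiag_chain_margins:
  fixes f g :: "nat \<times> nat \<Rightarrow> nat"
  assumes "antidiag_chain P" "finite P"
    and rows: "\<And>v. v \<in> P \<Longrightarrow> (\<Sum>u | u \<in> P \<and> fst u = fst v. f u) = (\<Sum>u | u \<in> P \<and> fst u = fst v. g u)"
    and cols: "\<And>v. v \<in> P \<Longrightarrow> (\<Sum>u | u \<in> P \<and> snd u = snd v. f u) = (\<Sum>u | u \<in> P \<and> snd u = snd v. g u)"
    and "v \<in> P"
  shows "f v = g v"
proof (rule ccontr)
  assume "f v \<noteq> g v"
  define D where "D = {u \<in> P. f u \<noteq> g u}"
  have "v \<in> D" using \<open>v \<in> P\<close> \<open>f v \<noteq> g v\<close> by (simp add: D_def)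
  then have "diagonal ` D \<noteq> {}" by blast
  have "finite (diagonal ` D)" using \<open>finite P\<close> by (simp add: D_def)
  then have "Min (diagonal ` D) \<in> diagonal ` D" using \<open>diagonal ` D \<noteq> {}\<close> by (rule Min_in)
  then obtain u where u: "u \<in> D" "diagonal u = Min (diagonal ` D)" by auto
  have first: "diagonal u \<le> diagonal w" if "w \<in> D" for w
    using u(2) \<open>finite (diagonal ` D)\<close> that by simp
  obtain i j where ij: "u = (i, j)" by fastforce
  have partner: "\<exists>w\<in>D. w \<noteq> u \<and> c w = c u"
    if "(\<Sum>w | w \<in> P \<and> c w = c u. f w) = (\<Sum>w | w \<in> P \<and> c w = c u. g w)" for c :: "nat \<times> nat \<Rightarrow> nat"
  proof (rule ccontr)
    assume none: "\<not> ?thesis"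
    let ?L = "{w. w \<in> P \<and> c w = c u}"
    have L: "finite ?L" "u \<in> ?L" using \<open>finite P\<close> u by (auto simp: D_def)
    have "sum f (?L - {u}) = sum g (?L - {u})"
      using none by (intro sum.cong) (auto simp: D_def)
    then have "f u = g u" using that sum.remove[OF L, of f] sum.remove[OF L, of g] by simp
    then show False using u by (simp add: D_def)
  qed
  have uP: "u \<in> P" using u by (simp add: D_def)
  obtain w where w: "w \<in> D" "w \<noteq> u" "fst w = fst u" using partner[of fst] rows[OF uP] by blast
  obtain w' where w': "w' \<in> D" "w' \<noteq> u" "snd w' = snd u" using partner[of snd] cols[OF uP] by blast
  obtain j1 where j1: "w = (i, j1)" using w ij by (cases w) auto
  obtain i1 where i1: "w' = (i1, j)" using w' ij by (cases w') auto
  have "j1 < j" using first[OF w(1)] w(2) ij j1 by (auto simp: diagonal_def)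
  moreover have "i < i1" using first[OF w'(1)] w'(2) ij i1 by (auto simp: diagonal_def)
  ultimately show False
    using antidiag_chainD[OF assms(1), of i j1 i1 j] w(1) w'(1) j1 i1 by (auto simp: D_def)
qed

lemma monic_sum_monom:
  assumes "finite K" "k \<in> K" and less: "\<And>l. l \<in> K \<Longrightarrow> l \<noteq> k \<Longrightarrow> e l < e k"
  shows "degree (\<Sum>l\<in>K. monom (1::'k::field) (e l)) = e k"
    and "lead_coeff (\<Sum>l\<in>K. monom (1::'k) (e l)) = 1"
proof -
  let ?p = "\<Sum>l\<in>K. monom (1::'k) (e l)"
  have "e l = e k \<longleftrightarrow> l = k" if "l \<in> K" for l using less[OF that] by (cases "l = k") auto
  then have "coeff ?p (e k) = (\<Sum>l\<in>K. if l = k then 1 else 0)"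
    unfolding coeff_sum coeff_monom by (intro sum.cong) auto
  then have coeff: "coeff ?p (e k) = 1" using assms(1,2) by simp
  have "degree ?p \<le> e k"
    using less by (intro degree_sum_le assms(1)) (metis degree_monom_le le_trans less_imp_le)
  moreover have "e k \<le> degree ?p" using coeff by (intro le_degree) simp
  ultimately show deg: "degree ?p = e k" by (rule order.antisym)
  show "lead_coeff ?p = 1" unfolding deg by (rule coeff)
qed

lemma subst_monomial_monic:
  fixes x :: "'v \<Rightarrow> 'k::field poly"
  assumes "\<And>v. v \<in> Poly_Mapping.keys a \<Longrightarrow> degree (x v) = w v"
    and "\<And>v. v \<in> Poly_Mapping.keys a \<Longrightarrow> lead_coeff (x v) = 1"
  shows "degree (subst_monomial x a) = weight w a" and "lead_coeff (subst_monomial x a) = 1"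
proof -
  have nz: "x v \<noteq> 0" if "v \<in> Poly_Mapping.keys a" for v using assms(2)[OF that] by auto
  then have "degree (subst_monomial x a)
      = (\<Sum>v\<in>Poly_Mapping.keys a. degree (x v ^ Poly_Mapping.lookup a v))"
    unfolding subst_monomial_def by (intro degree_prod_eq_sum_degree) auto
  also have "\<dots> = weight w a"
    unfolding weight_def using assms(1) nz by (intro sum.cong) (auto simp: degree_power_eq)
  finally show "degree (subst_monomial x a) = weight w a" .
  show "lead_coeff (subst_monomial x a) = 1"
    unfolding subst_monomial_def lead_coeff_prod lead_coeff_power
    using assms(2) by (intro prod.neutral) simp
qed

text \<open>If the substituted monomials have pairwise different degrees, their leading terms cannot
  cancel.\<close>

lemma subst_poly_nonzero:
  fixes x :: "nat \<times> nat \<Rightarrow> 'k::field poly"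
  assumes "f \<noteq> 0" and f: "f \<in> polys_in \<Omega>"
    and x: "\<And>v. v \<in> \<Omega> \<Longrightarrow> degree (x v) = w v" "\<And>v. v \<in> \<Omega> \<Longrightarrow> lead_coeff (x v) = 1"
    and inj: "inj_on (weight w) (Poly_Mapping.keys f)"
  shows "subst_poly x f \<noteq> 0"
proof -
  let ?A = "Poly_Mapping.keys f"
  have sub: "Poly_Mapping.keys a \<subseteq> \<Omega>" if "a \<in> ?A" for a using f that by (auto simp: polys_in_iff)
  have deg: "degree (subst_monomial x a) = weight w a" and lc: "lead_coeff (subst_monomial x a) = 1"
    if "a \<in> ?A" for a
    using subst_monomial_monic[of a x w] sub[OF that] x by blast+
  have "?A \<noteq> {}"
    using \<open>f \<noteq> 0\<close> sum_of_terms[of f] by (metis sum.empty)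
  then have "Max (weight w ` ?A) \<in> weight w ` ?A" by (intro Max_in) auto
  then obtain a where a: "a \<in> ?A" "weight w a = Max (weight w ` ?A)" by auto
  have less: "weight w b < weight w a" if "b \<in> ?A" "b \<noteq> a" for b
  proof -
    have "weight w b \<le> weight w a" unfolding a(2) using that by (intro Max_ge) auto
    then show ?thesis using inj that a(1) by (metis inj_on_eq_iff le_neq_implies_less)
  qed
  have "coeff (subst_poly x f) (weight w a)
      = (\<Sum>b\<in>?A. Poly_Mapping.lookup f b * coeff (subst_monomial x b) (weight w a))"
    by (simp add: subst_poly_def coeff_sum)
  also have "\<dots> = (\<Sum>b\<in>?A. if b = a then Poly_Mapping.lookup f a else 0)"
  proof (rule sum.cong[OF refl])
    fix b assume b: "b \<in> ?A"
    show "Poly_Mapping.lookup f b * coeff (subst_monomial x b) (weight w a) =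
        (if b = a then Poly_Mapping.lookup f a else 0)"
      using lc[OF b] deg[OF b] less[OF b] by (auto simp: coeff_eq_0)
  qed
  also have "\<dots> = Poly_Mapping.lookup f a" using a(1) by simp
  finally show ?thesis using a(1) by (auto simp: in_keys_iff)
qed

section \<open>Independence of the union of the paths\<close>

context
  fixes r m n :: nat and P :: "nat \<Rightarrow> (nat \<times> nat) set"
  assumes paths: "\<And>k. k \<in> {1..r} \<Longrightarrow> antidiag_path m n (k, n) (m, k) (P k)"
    and disj: "disjoint_family_on P {1..r}"
begin

text \<open>In row \<open>i\<close> this column separates the first \<open>q\<close> paths from the remaining ones. The value 0 stands
  for a row that the first \<open>q\<close> paths do not meet.\<close>

definition right_boundary :: "nat \<Rightarrow> nat \<Rightarrow> nat" where
  "right_boundary q i = Max (insert 0 {j. \<exists>k\<in>{1..q}. (i, j) \<in> P k})"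

text \<open>The row part of the weight \<open>row_weight i k + 2 * k * j\<close> of the cell \<open>(i, j)\<close> for the \<open>k\<close>-th
  summand. From \<open>k\<close> to \<open>k + 1\<close> this weight grows by \<open>2 * j - (2 * right_boundary k i + 1)\<close>, which
  is positive to the right of the \<open>k\<close>-th boundary and negative otherwise.\<close>

definition row_weight :: "nat \<Rightarrow> nat \<Rightarrow> nat" where
  "row_weight i k = (\<Sum>q = k..<r. 2 * right_boundary q i + 1)"

lemma right_boundary_separates:
  assumes ij: "(i, j) \<in> P k" and k: "k \<in> {1..r}" and q: "q \<in> {1..r}"
  shows "j \<le> right_boundary q i \<longleftrightarrow> k \<le> q"
proof -
  let ?J = "{j. \<exists>k\<in>{1..q}. (i, j) \<in> P k}"
  have "?J \<subseteq> {1..n}"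
  proof
    fix j assume "j \<in> ?J"
    then obtain l where "l \<in> {1..q}" "(i, j) \<in> P l" by blast
    then show "j \<in> {1..n}" using antidiag_path_box(1)[OF paths, of l i j] q by simp
  qed
  then have fin: "finite ?J" by (rule finite_subset) simp
  show ?thesis
  proof (cases "k \<le> q")
    case True
    then have "j \<in> ?J" using ij k by auto
    then show ?thesis unfolding right_boundary_def using fin True by (simp add: Max_ge)
  next
    case False
    have "j' < j" if j': "j' \<in> ?J" for j'
    proof -
      obtain l where l: "l \<in> {1..q}" "(i, j') \<in> P l" using j' by blast
      then have lk: "l \<in> {1..r}" "l < k" using q False by auto
      then have "P l \<inter> P k = {}" using disj k by (auto simp: disjoint_family_on_def)
      from disjoint_paths_row_order[OF paths[OF lk(1)] paths[OF k] lk(2) this l(2) ij]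
      show ?thesis .
    qed
    moreover have "0 < j" using antidiag_path_box(1)[OF paths[OF k] ij] by simp
    ultimately have "right_boundary q i < j" unfolding right_boundary_def
      using fin by (subst Max_less_iff) auto
    then show ?thesis using False by simp
  qed
qed

text \<open>On the \<open>k\<close>-th path the growth from one index to the next is positive up to \<open>k\<close> and negative
  from \<open>k\<close> on, because each boundary separates the paths; so the \<open>k\<close>-th weight is the strict
  maximum.\<close>

lemma row_weight_dominant:
  assumes ij: "(i, j) \<in> P k" and k: "k \<in> {1..r}" and l: "l \<in> {1..r}" and "l \<noteq> k"
  shows "row_weight i l + 2 * l * j < row_weight i k + 2 * k * j"
proof -
  note sep = right_boundary_separates[OF ij k]
  have split: "row_weight i a = (\<Sum>q = a..<b. 2 * right_boundary q i + 1) + row_weight i b"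
    if "a \<le> b" "b \<le> r" for a b
    unfolding row_weight_def using that by (subst sum.atLeastLessThan_concat) auto
  consider "l < k" | "k < l" using \<open>l \<noteq> k\<close> by linarith
  then show ?thesis
  proof cases
    case 1
    have "(\<Sum>q = l..<k. 2 * right_boundary q i + 1) < (\<Sum>q = l..<k. 2 * j)"
    proof (rule sum_strict_mono)
      fix q assume "q \<in> {l..<k}"
      then have "\<not> j \<le> right_boundary q i" using sep[of q] k l by auto
      then show "2 * right_boundary q i + 1 < 2 * j" by simp
    qed (use 1 in auto)
    moreover have "(\<Sum>q = l..<k. 2 * j) + 2 * l * j = 2 * k * j"
    proof -
      obtain d where "k = l + d" using 1 by (metis less_imp_add_positive)
      then show ?thesis by (simp add: algebra_simps)
    qed
    ultimately show ?thesis using split[of l k] 1 k by simp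
  next
    case 2
    have "(\<Sum>q = k..<l. 2 * j) < (\<Sum>q = k..<l. 2 * right_boundary q i + 1)"
    proof (rule sum_strict_mono)
      fix q assume "q \<in> {k..<l}"
      then have "j \<le> right_boundary q i" using sep[of q] k l by auto
      then show "2 * j < 2 * right_boundary q i + 1" by simp
    qed (use 2 in auto)
    moreover have "(\<Sum>q = k..<l. 2 * j) + 2 * k * j = 2 * l * j"
    proof -
      obtain d where "l = k + d" using 2 by (metis less_imp_add_positive)
      then show ?thesis by (simp add: algebra_simps)
    qed
    ultimately show ?thesis using split[of k l] 2 l by simp
  qed
qed

definition path_index :: "nat \<times> nat \<Rightarrow> nat" where
  "path_index v = (THE k. k \<in> {1..r} \<and> v \<in> P k)"

lemma path_index_eq:
  assumes "k \<in> {1..r}" "v \<in> P k"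
  shows "path_index v = k"
  unfolding path_index_def
proof (rule the_equality)
  fix l assume l: "l \<in> {1..r} \<and> v \<in> P l"
  show "l = k"
  proof (rule ccontr)
    assume "l \<noteq> k"
    then have "P l \<inter> P k = {}" using disjoint_family_onD[OF disj] l assms(1) by blast
    then show False using l assms(2) by blast
  qed
qed (use assms in blast)

text \<open>The weights only see, for each path, the row sums and the column sums of the exponents. By
  \<open>antidiag_chain_margins\<close> these determine the monomial, and generic weights separate them.\<close>

lemma generic_row_column_weights:
  assumes "finite A" and A: "\<And>a. a \<in> A \<Longrightarrow> Poly_Mapping.keys a \<subseteq> (\<Union>k\<in>{1..r}. P k)"
  shows "\<exists>p q :: nat \<Rightarrow> nat \<Rightarrow> nat.
    inj_on (weight (\<lambda>v. p (fst v) (path_index v) + q (path_index v) (snd v))) A"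
proof -
  define \<Omega> where "\<Omega> = (\<Union>k\<in>{1..r}. P k)"
  have "finite \<Omega>" unfolding \<Omega>_def
    by (rule finite_UN_I[OF finite_atLeastAtMost antidiag_path_finite[OF paths]])
  define row where "row v = (Inl (fst v, path_index v) :: nat \<times> nat + nat \<times> nat)" for v
  define col where "col v = (Inr (path_index v, snd v) :: nat \<times> nat + nat \<times> nat)" for v
  define I where "I = row ` \<Omega> \<union> col ` \<Omega>"
  have "finite I" using \<open>finite \<Omega>\<close> by (simp add: I_def)
  define margin where "margin a c = (\<Sum>v\<in>\<Omega>. Poly_Mapping.lookup a v *
    ((if row v = c then 1 else 0) + (if col v = c then 1 else 0)))" for a :: "nat \<times> nat \<Rightarrow>\<^sub>0 nat" and c
  obtain s where s: "\<And>a b. a \<in> A \<Longrightarrow> b \<in> A \<Longrightarrow>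
      (\<Sum>c\<in>I. s c * margin a c) = (\<Sum>c\<in>I. s c * margin b c) \<Longrightarrow> \<forall>c\<in>I. margin a c = margin b c"
    using separating_weights[OF \<open>finite I\<close>, of "margin ` A"] \<open>finite A\<close> by auto
  have weight_eq: "weight (\<lambda>v. s (row v) + s (col v)) a = (\<Sum>c\<in>I. s c * margin a c)" if "a \<in> A" for a
  proof -
    have "(\<Sum>c\<in>I. s c * margin a c) = (\<Sum>v\<in>\<Omega>. \<Sum>c\<in>I. s c * (Poly_Mapping.lookup a v *
        ((if row v = c then 1 else 0) + (if col v = c then 1 else 0))))"
      unfolding margin_def sum_distrib_left by (rule sum.swap)
    also have "\<dots> = (\<Sum>v\<in>\<Omega>. Poly_Mapping.lookup a v * (s (row v) + s (col v)))"
    proof (rule sum.cong[OF refl])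
      fix v assume "v \<in> \<Omega>"
      then have v: "row v \<in> I" "col v \<in> I" by (auto simp: I_def)
      have "(\<Sum>c\<in>I. s c * (Poly_Mapping.lookup a v *
          ((if row v = c then 1 else 0) + (if col v = c then 1 else 0))))
        = (\<Sum>c\<in>I. (if row v = c then Poly_Mapping.lookup a v * s c else 0)
            + (if col v = c then Poly_Mapping.lookup a v * s c else 0))"
        by (intro sum.cong) (auto simp: algebra_simps)
      also have "\<dots> = Poly_Mapping.lookup a v * (s (row v) + s (col v))"
        using v \<open>finite I\<close> by (simp add: sum.distrib distrib_left)
      finally show "(\<Sum>c\<in>I. s c * (Poly_Mapping.lookup a v *
          ((if row v = c then 1 else 0) + (if col v = c then 1 else 0))))
        = Poly_Mapping.lookup a v * (s (row v) + s (col v))" .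
    qed
    also have "\<dots> = weight (\<lambda>v. s (row v) + s (col v)) a"
      using weight_superset[OF \<open>finite \<Omega>\<close>, of a] A[OF that] by (simp add: \<Omega>_def)
    finally show ?thesis by simp
  qed
  have margin_row: "margin a (row v) = (\<Sum>u | u \<in> P k \<and> fst u = fst v. Poly_Mapping.lookup a u)"
    if "k \<in> {1..r}" "v \<in> P k" for a v k
  proof -
    have "margin a (row v) = (\<Sum>u\<in>\<Omega>. if row u = row v then Poly_Mapping.lookup a u else 0)"
      unfolding margin_def by (intro sum.cong) (auto simp: row_def col_def)
    also have "\<dots> = (\<Sum>u | u \<in> \<Omega> \<and> row u = row v. Poly_Mapping.lookup a u)"
      using \<open>finite \<Omega>\<close> by (simp add: sum.If_cases Int_def)
    also have "{u. u \<in> \<Omega> \<and> row u = row v} = {u. u \<in> P k \<and> fst u = fst v}"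
      using that path_index_eq by (auto simp: \<Omega>_def row_def)
    finally show ?thesis .
  qed
  have margin_col: "margin a (col v) = (\<Sum>u | u \<in> P k \<and> snd u = snd v. Poly_Mapping.lookup a u)"
    if "k \<in> {1..r}" "v \<in> P k" for a v k
  proof -
    have "margin a (col v) = (\<Sum>u\<in>\<Omega>. if col u = col v then Poly_Mapping.lookup a u else 0)"
      unfolding margin_def by (intro sum.cong) (auto simp: row_def col_def)
    also have "\<dots> = (\<Sum>u | u \<in> \<Omega> \<and> col u = col v. Poly_Mapping.lookup a u)"
      using \<open>finite \<Omega>\<close> by (simp add: sum.If_cases Int_def)
    also have "{u. u \<in> \<Omega> \<and> col u = col v} = {u. u \<in> P k \<and> snd u = snd v}"
      using that path_index_eq by (auto simp: \<Omega>_def col_def)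
    finally show ?thesis .
  qed
  have "inj_on (weight (\<lambda>v. s (row v) + s (col v))) A"
  proof (rule inj_onI, rule poly_mapping_eqI)
    fix a b v assume ab: "a \<in> A" "b \<in> A"
      and "weight (\<lambda>v. s (row v) + s (col v)) a = weight (\<lambda>v. s (row v) + s (col v)) b"
    then have eq: "\<forall>c\<in>I. margin a c = margin b c" using s[OF ab] weight_eq by simp
    show "Poly_Mapping.lookup a v = Poly_Mapping.lookup b v"
    proof (cases "v \<in> \<Omega>")
      case True
      then obtain k where k: "k \<in> {1..r}" "v \<in> P k" by (auto simp: \<Omega>_def)
      have margins: "margin a (row u) = margin b (row u)" "margin a (col u) = margin b (col u)"
        if "u \<in> P k" for u
      proof -
        have "u \<in> \<Omega>" using k(1) that unfolding \<Omega>_def by blast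
        then have "row u \<in> I" "col u \<in> I" by (simp_all add: I_def)
        then show "margin a (row u) = margin b (row u)" "margin a (col u) = margin b (col u)"
          using eq by blast+
      qed
      show ?thesis
      proof (rule antidiag_chain_margins)
        show "antidiag_chain (P k)" "finite (P k)" "v \<in> P k"
          using antidiag_path_chain[OF paths[OF k(1)]] antidiag_path_finite[OF paths[OF k(1)]] k(2)
          by blast+
        fix u assume u: "u \<in> P k"
        show "(\<Sum>t | t \<in> P k \<and> fst t = fst u. Poly_Mapping.lookup a t)
            = (\<Sum>t | t \<in> P k \<and> fst t = fst u. Poly_Mapping.lookup b t)"
          using margins(1)[OF u] by (simp only: margin_row[OF k(1) u])
        show "(\<Sum>t | t \<in> P k \<and> snd t = snd u. Poly_Mapping.lookup a t)
            = (\<Sum>t | t \<in> P k \<and> snd t = snd u. Poly_Mapping.lookup b t)"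
          using margins(2)[OF u] by (simp only: margin_col[OF k(1) u])
      qed
    next
      case False
      then have "v \<notin> Poly_Mapping.keys a" "v \<notin> Poly_Mapping.keys b"
        using A ab by (auto simp: \<Omega>_def)
      then show ?thesis by (simp add: in_keys_iff)
    qed
  qed
  then show ?thesis
    by (intro exI[of _ "\<lambda>i k. s (Inl (i, k))"] exI[of _ "\<lambda>k j. s (Inr (k, j))"])
       (simp add: row_def col_def)
qed

text \<open>Substitute \<open>z\<^sub>i\<^sub>j = (\<Sum>k. t ^ (U i k + V k j))\<close>. The dominant weights, scaled by a large \<open>N\<close>, make
  the \<open>k\<close>-th summand the leading term on the \<open>k\<close>-th path; the generic weights, added as a small
  perturbation, make the degrees of different monomials different, even modulo \<open>N\<close>.\<close>

lemma paths_independent: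
  "det_ideal (r + 1) m n \<inter> polys_in (\<Union>k\<in>{1..r}. P k) = {0 :: 'k::field entry_poly}"
proof (intro equalityI subsetI)
  fix f :: "'k entry_poly" assume "f \<in> det_ideal (r + 1) m n \<inter> polys_in (\<Union>k\<in>{1..r}. P k)"
  then have f: "f \<in> det_ideal (r + 1) m n" "f \<in> polys_in (\<Union>k\<in>{1..r}. P k)" by auto
  define A where "A = Poly_Mapping.keys f"
  have A: "finite A" "\<And>a. a \<in> A \<Longrightarrow> Poly_Mapping.keys a \<subseteq> (\<Union>k\<in>{1..r}. P k)"
    using f(2) by (auto simp: A_def polys_in_iff)
  obtain p q :: "nat \<Rightarrow> nat \<Rightarrow> nat" where
    inj: "inj_on (weight (\<lambda>v. p (fst v) (path_index v) + q (path_index v) (snd v))) A"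
    using generic_row_column_weights[OF A] by blast
  define small where "small = weight (\<lambda>v. p (fst v) (path_index v) + q (path_index v) (snd v))"
  \<comment> \<open>\<open>N\<close> exceeds the perturbation of every monomial of \<open>f\<close> and of every exponent \<open>U i k + V k j\<close>\<close>
  define N where "N = Suc (sum small A + (\<Sum>i = 1..m. \<Sum>k = 1..r. p i k) + (\<Sum>k = 1..r. \<Sum>j = 1..n. q k j))"
  have small_less: "small a < N" if "a \<in> A" for a
    using member_le_sum[OF that, of small] A(1) by (simp add: N_def)
  have pq_less: "p i k + q k j < N" if "(i, j) \<in> grid m n" "k \<in> {1..r}" for i j k
  proof -
    have "p i k \<le> (\<Sum>k = 1..r. p i k)" "(\<Sum>k = 1..r. p i k) \<le> (\<Sum>i = 1..m. \<Sum>k = 1..r. p i k)"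
      "q k j \<le> (\<Sum>j = 1..n. q k j)" "(\<Sum>j = 1..n. q k j) \<le> (\<Sum>k = 1..r. \<Sum>j = 1..n. q k j)"
      using that
      by (auto intro: member_le_sum[of i "{1..m}" "\<lambda>i. \<Sum>k = 1..r. p i k", simplified]
          member_le_sum[of k "{1..r}" "\<lambda>k. \<Sum>j = 1..n. q k j", simplified]
          member_le_sum[of k "{1..r}" "p i", simplified] member_le_sum[of j "{1..n}" "q k", simplified])
    then show ?thesis by (simp add: N_def)
  qed
  define U where "U i k = N * row_weight i k + p i k" for i k
  define V where "V k j = N * (2 * k * j) + q k j" for k j
  define x :: "nat \<times> nat \<Rightarrow> 'k poly" where
    "x = (\<lambda>(i, j). \<Sum>k = 1..r. monom 1 (U i k) * monom 1 (V k j))"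
  define w where "w v = U (fst v) (path_index v) + V (path_index v) (snd v)" for v
  have monic: "degree (x v) = w v \<and> lead_coeff (x v) = 1" if v: "v \<in> (\<Union>k\<in>{1..r}. P k)" for v
  proof -
    obtain i j where ij: "v = (i, j)" by fastforce
    obtain k where k: "k \<in> {1..r}" "(i, j) \<in> P k" using v ij by auto
    have "U i l + V l j < U i k + V k j" if l: "l \<in> {1..r}" "l \<noteq> k" for l
    proof -
      have "N * (row_weight i l + 2 * l * j + 1) \<le> N * (row_weight i k + 2 * k * j)"
        using row_weight_dominant[OF k(2,1) l] by (intro mult_le_mono2) simp
      moreover have "p i l + q l j < N"
        using antidiag_path_box(1)[OF paths[OF k(1)] k(2)] l(1) by (rule pq_less)
      ultimately show ?thesis unfolding U_def V_def by (simp add: distrib_left)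
    qed
    from monic_sum_monom[of "{1..r}" k "\<lambda>k. U i k + V k j", OF _ k(1) this, where ?'k = 'k]
    show ?thesis using path_index_eq[OF k] ij by (simp add: x_def w_def mult_monom)
  qed
  have w_split: "weight w a = N * weight (\<lambda>v. row_weight (fst v) (path_index v)
      + 2 * path_index v * snd v) a + small a" for a
    unfolding weight_def small_def w_def U_def V_def
    by (simp add: sum_distrib_left sum.distrib[symmetric] algebra_simps)
  have "inj_on (weight w) A"
  proof (rule inj_onI)
    fix a b assume ab: "a \<in> A" "b \<in> A" "weight w a = weight w b"
    \<comment> \<open>the unperturbed part of \<open>w\<close> is a multiple of \<open>N\<close>\<close>
    have "small c = weight w c mod N" if "c \<in> A" for c
      using small_less[OF that] by (simp add: w_split)
    then have "small a = small b" using ab by simp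
    then show "a = b" using inj ab by (auto simp: small_def dest: inj_onD)
  qed
  then have inj_w: "inj_on (weight w) (Poly_Mapping.keys f)" by (simp only: A_def)
  have vanish: "subst_poly x f = 0"
    by (rule subst_poly_det_ideal_zero[OF _ f(1), of _ "\<lambda>i k. monom 1 (U i k)" "\<lambda>k j. monom 1 (V k j)"])
       (simp add: x_def)
  have "f = 0"
  proof (rule ccontr)
    assume "f \<noteq> 0"
    from subst_poly_nonzero[OF this f(2) conjunct1[OF monic] conjunct2[OF monic] inj_w] vanish
    show False by (rule notE)
  qed
  then show "f \<in> {0}" by simp
qed (auto simp: zero_in_det_ideal polys_in_zero)

end

section \<open>The union of the paths is a base\<close>

theorem theorem7p1:
  fixes r m n :: nat and P :: "nat \<Rightarrow> (nat \<times> nat) set"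
  assumes "infinite (UNIV :: 'k::field set)"
    and "0 < r" and "0 < m" and "0 < n" and "r < min m n"
    and "\<And>k. k \<in> {1..r} \<Longrightarrow> antidiag_path m n (k, n) (m, k) (P k)"
    and "disjoint_family_on P {1..r}"
  shows "is_base (determinantal_matroid TYPE('k) r m n) (\<Union>k\<in>{1..r}. P k)"
proof -
  let ?\<Omega> = "\<Union>k\<in>{1..r}. P k"
  have indep: "?\<Omega> \<in> determinantal_matroid TYPE('k) r m n"
    unfolding determinantal_matroid_def
    using paths_in_grid[OF assms(6,7)] paths_independent[OF assms(6,7), where ?'k = 'k] by simp
  have maximal: "B = ?\<Omega>" if B: "B \<in> determinantal_matroid TYPE('k) r m n" "?\<Omega> \<subseteq> B" for B
  proof (rule ccontr)
    assume "B \<noteq> ?\<Omega>"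
    have "B \<subseteq> grid m n" and trivial: "det_ideal (r + 1) m n \<inter> polys_in B = {0 :: 'k entry_poly}"
      using B(1) by (auto simp: determinantal_matroid_def)
    have "finite B" using \<open>B \<subseteq> grid m n\<close> by (rule finite_subset) simp
    then have "card ?\<Omega> < card B" using B(2) \<open>B \<noteq> ?\<Omega>\<close> by (intro psubset_card_mono psubsetI) auto
    then have "card S < card B" if "S \<subseteq> grid m n" "\<not> has_diagonal (r + 1) S" for S
      using card_le_card_paths[OF assms(6,7) that] by simp
    from dependent_if_larger_than_diagonal_free[OF _ \<open>B \<subseteq> grid m n\<close> this, where ?'k = 'k] trivial
    show False by auto
  qed
  show ?thesis unfolding is_base_def using indep maximal by blast
qed

end
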